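(* Let $n\ge 3$, $k\in\{1,\dots,n\}$, $0<\gamma<k$, and let $b\in C(\mathbb{R}^n)$ be positive and radial, $b(x)=b(|x|)$. Then the problem $$S_k(D^2u)=b(x)u^\gamma\ \text{ in }\mathbb{R}^n,\qquad u(x)\to\infty\ \text{ as }|x|\to\infty,$$ admits a positive entire radial solution $u\in\Phi^k(\mathbb{R}^n)$ if and only if $$\int_0^\infty\left(\frac{n\,r^{k-n}}{\binom nk}\int_0^r s^{n-1}b(s)\,ds\right)^{1/k}dr=\infty .$$
   Context: For a $C^2$ function $u$, $S_k(D^2u)=\sigma_k(\lambda(D^2u))$, where $\lambda(D^2u)=(\lambda_1,\dots,\lambda_n)$ are the eigenvalues of the Hessian $D^2u$ and $\sigma_k(\lambda)=\sum_{1\le i_1<\dots<i_k\le n}\lambda_{i_1}\cdots\lambda_{i_k}$. Let $\Gamma_k=\{\lambda\in\mathbb{R}^n:\sigma_l(\lambda)>0,\ 1\le l\le k\}$. For a domain $\Omega\subseteq\mathbb{R}^n$, $\Phi^k(\Omega)=\{u\in C^2(\Omega):\lambda(D^2u(x))\in\Gamma_k\text{ for all }x\in\Omega\}$ is the class of $k$-convex functions on $\Omega$. An entire solution is one defined on all of $\mathbb{R}^n$; radial means depending only on $|x|$. *)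

theory Defs
  imports "HOL-Analysis.Analysis"
begin

definition gradient :: "(real^'n \<Rightarrow> real) \<Rightarrow> real^'n \<Rightarrow> real^'n" where
  "gradient u x = (\<chi> i. frechet_derivative u (at x) (axis i 1))"

definition hessian :: "(real^'n \<Rightarrow> real) \<Rightarrow> real^'n \<Rightarrow> real^'n^'n" where
  "hessian u x = jacobian (gradient u) (at x)"

text \<open>The derivatives below are two-sided ones, taken in the ambient space, so this is the
  class of twice continuously differentiable functions for open \<open>\<Omega>\<close>.\<close>

definition C2_on :: "(real^'n) set \<Rightarrow> (real^'n \<Rightarrow> real) \<Rightarrow> bool" where
  "C2_on \<Omega> u \<longleftrightarrow>
     (\<forall>x\<in>\<Omega>. u differentiable (at x)) \<and>
     (\<forall>x\<in>\<Omega>. gradient u differentiable (at x)) \<and>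
     continuous_on \<Omega> (hessian u)"

text \<open>The vector of eigenvalues, repeated according to algebraic multiplicity, read off from
  the characteristic polynomial. It exists for every symmetric matrix, in particular for the
  Hessian of a twice continuously differentiable function, and is unique up to a permutation
  of its components; it is only used in functions symmetric in these components.\<close>

definition eigenvalues :: "real^'n^'n \<Rightarrow> real^'n" where
  "eigenvalues A = (SOME l. \<forall>t. det (mat t - A) = (\<Prod>i\<in>UNIV. t - l $ i))"

definition sigma :: "nat \<Rightarrow> real^'n \<Rightarrow> real" where
  "sigma k l = (\<Sum>I | I \<subseteq> UNIV \<and> card I = k. \<Prod>i\<in>I. l $ i)"

definition S :: "nat \<Rightarrow> real^'n^'n \<Rightarrow> real" where
  "S k A = sigma k (eigenvalues A)"

definition Gamma_cone :: "nat \<Rightarrow> (real^'n) set" where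
  "Gamma_cone k = {l. \<forall>j\<in>{1..k}. sigma j l > 0}"

definition k_convex :: "nat \<Rightarrow> (real^'n) set \<Rightarrow> (real^'n \<Rightarrow> real) set" where
  "k_convex k \<Omega> = {u. C2_on \<Omega> u \<and> (\<forall>x\<in>\<Omega>. eigenvalues (hessian u x) \<in> Gamma_cone k)}"

definition radial :: "(real^'n \<Rightarrow> real) \<Rightarrow> bool" where
  "radial u \<longleftrightarrow> (\<forall>x y. norm x = norm y \<longrightarrow> u x = u y)"

end

theory Submission
  imports Defs
begin

text \<open>
  For a radial function \<open>u x = v (norm x)\<close> put \<open>q r = v' r / r\<close> and \<open>p r = r * q' r\<close>. The gradient is
  \<open>q (norm x) *\<^sub>R x\<close>, so the Hessian is \<open>q\<close> times the identity plus \<open>p\<close> times the orthogonal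
  projection to the radial direction. Its eigenvalues are \<open>q\<close>, with multiplicity \<open>n - 1\<close>, and
  \<open>q + p\<close>, and counting subsets gives (\<open>S_radial_matrix\<close>)
  \<open>S j = (n choose j) / n * q ^ (j - 1) * (j * p + n * q)\<close>.
  Since \<open>r ^ (n - 1)\<close> times the last two factors is the derivative of \<open>r ^ n * q ^ j\<close>, the equation
  \<open>S k = b * u powr \<gamma>\<close> integrates once and becomes
  \<open>v' r = r * (c * M r) powr (1 / k)\<close>, where \<open>c = n / (n choose k)\<close> and
  \<open>M r = r powi (- n) * (integral of s ^ (n - 1) * b s * v s powr \<gamma> over {0..r})\<close>.
  Call the right-hand side \<open>slope v r\<close>. The integrand of the criterion is \<open>slope 1\<close>, that is, the
  slope for the constant profile 1.

  If \<open>v\<close> is increasing, then \<open>v s powr \<gamma> \<le> v r powr \<gamma>\<close> under the integral, whence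
  \<open>slope v \<le> v powr (\<gamma> / k) * slope 1\<close> (\<open>slope_le\<close>). Because \<open>\<gamma> < k\<close>, this separable inequality
  integrates to a bound of \<open>v powr (1 - \<gamma> / k)\<close> by a constant plus a multiple of the integral of
  \<open>slope 1\<close> (\<open>solution_energy_bound\<close>). A solution tending to infinity therefore forces the
  integral to diverge.

  Conversely, equality in the separable inequality defines an explicit supersolution, \<open>barrier\<close>,
  which is finite on the whole half-line. The monotone iteration of the integral equation
  \<open>v r = 1 + integral {0..r} (slope v)\<close> from the constant 1 stays below it, and its limit is a global
  solution (\<open>exists_global_profile\<close>). It satisfies \<open>v \<ge> 1\<close>, hence \<open>v' \<ge> slope 1\<close>, and tends to
  infinity if the integral diverges. The associated \<open>u\<close> is twice continuously differentiable also at
  the origin because \<open>M\<close> is continuous there and \<open>p\<close> tends to 0. It is k-convex because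
  \<open>q > 0\<close> and \<open>k * p + n * q > 0\<close> imply \<open>j * p + n * q > 0\<close> for all \<open>j \<le> k\<close>.
\<close>

section \<open>Hessians with a rotationally symmetric spectrum\<close>

text \<open>
  Up to sign, the elementary symmetric functions are the coefficients of the monic polynomial with
  the given roots. So they may be computed from any vector of eigenvalues, not just from the chosen
  one.
\<close>
lemma sigma_cong_charpoly:
  fixes l m :: "real^'n"
  assumes "\<And>t. (\<Prod>i\<in>UNIV. t - l $ i) = (\<Prod>i\<in>UNIV. t - m $ i)"
  shows "sigma k l = sigma k m"
proof (cases "k \<le> CARD('n)")
  case False
  have "{I. I \<subseteq> (UNIV::'n set) \<and> card I = k} = {}"
    using False card_mono[OF finite_class.finite_UNIV subset_UNIV] by fastforce
  then show ?thesis by (simp add: sigma_def)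
next
  case True
  define c where "c v j = (-1) ^ (CARD('n) - j) * sigma (CARD('n) - j) v" for v :: "real^'n" and j
  have expand: "(\<Prod>i\<in>UNIV. t - v $ i) = (\<Sum>j\<le>CARD('n). c v j * t ^ j)" for v :: "real^'n" and t
  proof -
    have "(\<Prod>i\<in>UNIV. t - v $ i) = (\<Prod>i\<in>UNIV. t + (- v $ i))" by simp
    also have "\<dots> = (\<Sum>B\<in>Pow UNIV. t ^ card B * (\<Prod>i\<in>UNIV - B. - v $ i))"
      by (subst prod_add) (simp_all add: Compl_eq_Diff_UNIV)
    also have "\<dots> = (\<Sum>j\<le>CARD('n). \<Sum>B | B \<in> Pow UNIV \<and> card B = j. t ^ card B * (\<Prod>i\<in>UNIV - B. - v $ i))"
      by (rule sum.group [symmetric]) (auto intro: card_mono)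
    also have "\<dots> = (\<Sum>j\<le>CARD('n). c v j * t ^ j)"
    proof (rule sum.cong [OF refl])
      fix j assume j: "j \<in> {..CARD('n)}"
      have "(\<Sum>B | B \<in> Pow UNIV \<and> card B = j. t ^ card B * (\<Prod>i\<in>UNIV - B. - v $ i))
          = (\<Sum>I | I \<subseteq> UNIV \<and> card I = CARD('n) - j. t ^ j * (\<Prod>i\<in>I. - v $ i))"
        by (rule sum.reindex_bij_witness [where i = "\<lambda>I. UNIV - I" and j = "\<lambda>B. UNIV - B"])
           (use j in \<open>auto simp: card_Diff_subset\<close>)
      also have "\<dots> = c v j * t ^ j"
        by (simp add: c_def sigma_def prod_uminus sum_distrib_left sum_distrib_right mult_ac)
      finally show "(\<Sum>B | B \<in> Pow UNIV \<and> card B = j. t ^ card B * (\<Prod>i\<in>UNIV - B. - v $ i)) = c v j * t ^ j" .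
    qed
    finally show ?thesis .
  qed
  have "\<forall>t. (\<Sum>j\<le>CARD('n). c l j * t ^ j) = (\<Sum>j\<le>CARD('n). c m j * t ^ j)"
    using assms expand by metis
  then have "\<forall>j\<le>CARD('n). c l j = c m j"
    by (simp only: polyfun_eq_coeffs)
  then have "c l (CARD('n) - k) = c m (CARD('n) - k)"
    by simp
  then show ?thesis
    using True by (simp add: c_def)
qed

lemma S_eq_sigma:
  fixes A :: "real^'n^'n" and l :: "real^'n"
  assumes "\<And>t. det (mat t - A) = (\<Prod>i\<in>UNIV. t - l $ i)"
  shows "S k A = sigma k l"
proof -
  have "\<exists>l :: real^'n. \<forall>t. det (mat t - A) = (\<Prod>i\<in>UNIV. t - l $ i)"
    by (rule exI [of _ l]) (simp add: assms)
  from someI_ex [OF this]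
  have "\<forall>t. det (mat t - A) = (\<Prod>i\<in>UNIV. t - eigenvalues A $ i)"
    unfolding eigenvalues_def .
  then show ?thesis
    unfolding S_def using assms by (intro sigma_cong_charpoly) metis
qed

text \<open>
  For a unit vector \<open>e\<close>, this is the symmetric matrix with eigenvalue \<open>q + p\<close> on the line through
  \<open>e\<close> and \<open>q\<close> on its orthogonal complement.
\<close>
definition radial_matrix :: "real \<Rightarrow> real \<Rightarrow> real^'n \<Rightarrow> real^'n^'n" where
  "radial_matrix q p e = (\<chi> i j. (if i = j then q else 0) + p * e $ i * e $ j)"

text \<open>
  An orthogonal matrix taking a basis vector to \<open>e\<close> diagonalises the radial matrix.
\<close>
lemma det_mat_minus_radial_matrix:
  fixes e :: "real^'n" and m :: 'n
  assumes "norm e = 1"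
  shows "det (mat t - radial_matrix q p e) = (\<Prod>i\<in>UNIV. t - (\<chi> i. if i = m then q + p else q) $ i)"
proof -
  obtain A :: "real^'n^'n" where A: "orthogonal_matrix A" "A *v (axis m 1) = e"
    using orthogonal_matrix_exists_basis assms by metis
  define d where "d i = (if i = m then t - q - p else t - q)" for i
  define D :: "real^'n^'n" where "D = (\<chi> i j. if i = j then d i else 0)"
  have e: "e $ i = A $ i $ m" for i
    using A(2) by (auto simp: matrix_vector_mult_def axis_def if_distrib cong: if_cong)
  have orth: "(\<Sum>l\<in>UNIV. A $ i $ l * A $ j $ l) = (if i = j then 1 else 0)" for i j
  proof -
    have "(A ** transpose A) $ i $ j = mat 1 $ i $ j"
      using A(1) by (simp add: orthogonal_matrix_def)
    then show ?thesis by (simp add: matrix_matrix_mult_def transpose_def mat_def)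
  qed
  have "mat t - radial_matrix q p e = A ** D ** transpose A"
  proof (simp add: vec_eq_iff, intro allI)
    fix i j
    have "(A ** D ** transpose A) $ i $ j = (\<Sum>l\<in>UNIV. A $ i $ l * d l * A $ j $ l)"
      by (simp add: matrix_matrix_mult_def transpose_def D_def if_distrib cong: if_cong)
    also have "\<dots> = (\<Sum>l\<in>UNIV. (t - q) * (A $ i $ l * A $ j $ l) - (if l = m then p * A $ i $ l * A $ j $ l else 0))"
      by (intro sum.cong refl) (auto simp: d_def algebra_simps)
    also have "\<dots> = (t - q) * (if i = j then 1 else 0) - p * A $ i $ m * A $ j $ m"
      by (simp add: sum_subtractf sum_distrib_left [symmetric] orth)
    also have "\<dots> = mat t $ i $ j - radial_matrix q p e $ i $ j"
      by (simp add: mat_def radial_matrix_def e)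
    finally show "mat t $ i $ j - radial_matrix q p e $ i $ j = (A ** D ** transpose A) $ i $ j" by simp
  qed
  then have "det (mat t - radial_matrix q p e) = det (A ** transpose A) * det D"
    by (simp add: det_mul)
  also have "\<dots> = det D"
    using A(1) by (simp add: orthogonal_matrix_def)
  also have "\<dots> = prod d UNIV"
    by (subst det_diagonal) (auto simp: D_def)
  finally show ?thesis
    by (simp add: d_def if_distrib [of "\<lambda>x. t - x"] diff_diff_eq cong: if_cong)
qed

text \<open>
  The two terms count the \<open>j\<close>-element index sets that contain \<open>m\<close> and those that do not.
\<close>
lemma sigma_two_values:
  fixes m :: "'n::finite" and x y :: real
  assumes "1 \<le> j"
  shows "sigma j (\<chi> i. if i = m then x else y)
    = real ((CARD('n) - 1) choose (j - 1)) * x * y ^ (j - 1) + real ((CARD('n) - 1) choose j) * y ^ j"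
proof -
  let ?l = "\<lambda>i. if i = m then x else y"
  let ?U = "{I. I \<subseteq> UNIV \<and> card I = j} :: 'n set set"
  let ?A = "{I. I \<subseteq> UNIV - {m} \<and> card I = j}"
  let ?B = "{I. I \<subseteq> UNIV - {m} \<and> card I = j - 1}"
  have split: "?U = ?A \<union> insert m ` ?B"
  proof (intro equalityI subsetI)
    fix I assume I: "I \<in> ?U"
    show "I \<in> ?A \<union> insert m ` ?B"
    proof (cases "m \<in> I")
      case True
      then have "I = insert m (I - {m})" "I - {m} \<in> ?B" using I by auto
      then show ?thesis by blast
    qed (use I in auto)
  next
    fix I assume "I \<in> ?A \<union> insert m ` ?B"
    moreover have "card (insert m J) = j" if "J \<subseteq> UNIV - {m}" "card J = j - 1" for J
      using that assms by (subst card_insert_disjoint) auto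
    ultimately show "I \<in> ?U" by auto
  qed
  have inj: "inj_on (insert m) ?B"
    by (intro inj_onI) (metis (lifting) Diff_insert_absorb DiffE mem_Collect_eq singletonI subset_iff)
  have "sigma j (vec_lambda ?l) = (\<Sum>I\<in>?U. \<Prod>i\<in>I. ?l i)"
    by (simp add: sigma_def)
  also have "\<dots> = (\<Sum>I\<in>?A. \<Prod>i\<in>I. ?l i) + (\<Sum>I\<in>insert m ` ?B. \<Prod>i\<in>I. ?l i)"
    unfolding split by (rule sum.union_disjoint) auto
  also have "(\<Sum>I\<in>?A. \<Prod>i\<in>I. ?l i) = (\<Sum>I\<in>?A. y ^ j)"
  proof (intro sum.cong refl)
    fix I assume I: "I \<in> ?A"
    have "(\<Prod>i\<in>I. ?l i) = (\<Prod>i\<in>I. y)" by (intro prod.cong) (use I in auto)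
    then show "(\<Prod>i\<in>I. ?l i) = y ^ j" using I by simp
  qed
  also have "\<dots> = real ((CARD('n) - 1) choose j) * y ^ j"
    by (simp add: n_subsets)
  also have "(\<Sum>I\<in>insert m ` ?B. \<Prod>i\<in>I. ?l i) = (\<Sum>I\<in>?B. x * y ^ (j - 1))"
  proof (subst sum.reindex [OF inj], intro sum.cong refl, unfold o_def)
    fix I assume I: "I \<in> ?B"
    have "(\<Prod>i\<in>insert m I. ?l i) = x * (\<Prod>i\<in>I. ?l i)"
      using I by (subst prod.insert) auto
    also have "(\<Prod>i\<in>I. ?l i) = (\<Prod>i\<in>I. y)" by (intro prod.cong) (use I in auto)
    finally show "(\<Prod>i\<in>insert m I. ?l i) = x * y ^ (j - 1)" using I by simp
  qed
  also have "\<dots> = real ((CARD('n) - 1) choose (j - 1)) * x * y ^ (j - 1)"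
    by (simp add: n_subsets)
  finally show ?thesis by simp
qed

text \<open>
  The binomial coefficients combine by \<open>j * (n choose j) = n * ((n - 1) choose (j - 1))\<close> and
  Pascal's rule. The case \<open>p = 0\<close> is the origin, where \<open>sgn x\<close> vanishes and the radial direction
  is undefined.
\<close>
lemma S_radial_matrix:
  fixes e :: "real^'n"
  assumes "norm e = 1 \<or> p = 0" "1 \<le> j"
  shows "S j (radial_matrix q p e)
    = real (CARD('n) choose j) / real CARD('n) * q ^ (j - 1) * (real j * p + real CARD('n) * q)"
proof -
  obtain m :: 'n where True by simp
  define e' :: "real^'n" where "e' = (if norm e = 1 then e else axis m 1)"
  have e': "norm e' = 1" "radial_matrix q p e = radial_matrix q p e'"
    using assms by (auto simp: e'_def radial_matrix_def)
  obtain i where i: "j = Suc i" using assms(2) by (cases j) auto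
  obtain N where N: "CARD('n) = Suc N" by (metis gr0_conv_Suc zero_less_card_finite)
  have "real (Suc i * (Suc N choose Suc i)) = real (Suc N * (N choose i))"
    by (simp only: Suc_times_binomial_eq mult.commute)
  then have c1: "real (N choose i) = real (Suc i) * real (Suc N choose Suc i) / real (Suc N)"
    by (simp add: field_simps del: binomial_Suc_Suc)
  have c2: "real (N choose Suc i) = real (Suc N choose Suc i) - real (N choose i)"
    by simp
  have "S j (radial_matrix q p e) = sigma j (\<chi> i. if i = m then q + p else q)"
    unfolding e' by (rule S_eq_sigma) (rule det_mat_minus_radial_matrix [OF e'(1)])
  also have "\<dots> = real (N choose i) * (q + p) * q ^ i + real (N choose Suc i) * q ^ Suc i"
    by (subst sigma_two_values [OF assms(2)]) (simp add: i N)
  also have "\<dots> = real (N choose i) * p * q ^ i + real (Suc N choose Suc i) * q ^ Suc i"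
    unfolding c2 by (simp add: algebra_simps del: binomial_Suc_Suc)
  also have "\<dots> = real (Suc N choose Suc i) / real (Suc N) * q ^ i * (real (Suc i) * p + real (Suc N) * q)"
    unfolding c1 by (simp add: field_simps del: binomial_Suc_Suc of_nat_Suc)
  finally show ?thesis by (simp add: i N)
qed

section \<open>Derivatives of radial functions\<close>

lemma gradient_eqI:
  assumes "(u has_derivative (\<lambda>h. d \<bullet> h)) (at x)"
  shows "gradient u x = d"
  by (simp add: gradient_def vec_eq_iff inner_axis flip: frechet_derivative_at [OF assms])

lemma has_derivative_gradient:
  fixes u :: "real^'n \<Rightarrow> real"
  assumes "u differentiable (at x)"
  shows "(u has_derivative (\<lambda>h. gradient u x \<bullet> h)) (at x)"
proof -
  let ?f = "frechet_derivative u (at x)"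
  have D: "(u has_derivative ?f) (at x)"
    using assms frechet_derivative_works by blast
  then interpret linear ?f by (rule has_derivative_linear)
  have "?f h = gradient u x \<bullet> h" for h
  proof -
    have "?f h = ?f (\<Sum>i\<in>UNIV. h $ i *\<^sub>R axis i 1)"
      by (simp add: basis_expansion flip: scalar_mult_eq_scaleR)
    also have "\<dots> = gradient u x \<bullet> h"
      by (simp add: sum scale gradient_def inner_vec_def mult.commute)
    finally show ?thesis .
  qed
  then have "?f = (\<lambda>h. gradient u x \<bullet> h)" by blast
  with D show ?thesis by simp
qed

lemma hessian_eqI:
  assumes "(gradient u has_derivative D) (at x)"
  shows "hessian u x = matrix D"
  using frechet_derivative_at [OF assms] by (simp add: hessian_def jacobian_def)

lemma has_derivative_radial:
  fixes x :: "'a::real_inner"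
  assumes "(v has_real_derivative d) (at (norm x))" "x \<noteq> 0"
  shows "((\<lambda>y. v (norm y)) has_derivative (\<lambda>h. ((d / norm x) *\<^sub>R x) \<bullet> h)) (at x)"
proof -
  have "((\<lambda>y. v (norm y)) has_derivative (\<lambda>h. d * (h \<bullet> sgn x))) (at x)"
    using has_derivative_compose [OF has_derivative_norm [OF assms(2)] assms(1) [unfolded has_field_derivative_def]]
    by simp
  then show ?thesis
    by (rule has_derivative_eq_rhs) (auto simp: sgn_div_norm inner_commute field_simps)
qed

lemma has_derivative_radial_field:
  fixes x :: "'a::real_inner"
  assumes "(Q has_real_derivative d) (at (norm x))" "x \<noteq> 0"
  shows "((\<lambda>y. Q (norm y) *\<^sub>R y) has_derivative
    (\<lambda>h. Q (norm x) *\<^sub>R h + (norm x * d * (sgn x \<bullet> h)) *\<^sub>R sgn x)) (at x)"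
proof -
  have "((\<lambda>y. Q (norm y) *\<^sub>R y) has_derivative
    (\<lambda>h. Q (norm x) *\<^sub>R h + (((d / norm x) *\<^sub>R x) \<bullet> h) *\<^sub>R x)) (at x)"
    by (rule has_derivative_scaleR [OF has_derivative_radial [OF assms] has_derivative_ident])
  then show ?thesis
    by (rule has_derivative_eq_rhs) (use assms(2) in \<open>auto simp: sgn_div_norm field_simps\<close>)
qed

lemma matrix_radial_matrix:
  "matrix (\<lambda>h. q *\<^sub>R h + (p * (e \<bullet> h)) *\<^sub>R e) = radial_matrix q p (e :: real^'n)"
proof -
  have "q * axis j 1 $ i + p * (e \<bullet> axis j 1) * e $ i = (if i = j then q else 0) + p * e $ i * e $ j" for i j
    unfolding inner_axis by (simp add: axis_def)
  then show ?thesis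
    by (simp add: vec_eq_iff matrix_def radial_matrix_def)
qed

text \<open>
  A radial function is as smooth as its profile away from the origin. At the origin, the vanishing
  of \<open>v'\<close> gives differentiability, continuity of \<open>q\<close> gives a second derivative
  \<open>q 0\<close> times the identity, and \<open>p 0 = 0\<close> makes the Hessian continuous although the radial
  direction has no limit there.
\<close>
lemma radial_C2:
  fixes v q p :: "real \<Rightarrow> real"
  defines "u \<equiv> \<lambda>x :: real^'n. v (norm x)"
  assumes v: "\<And>r. 0 < r \<Longrightarrow> (v has_real_derivative r * q r) (at r)"
    and v0: "(v has_real_derivative 0) (at 0 within {0..})"
    and q: "\<And>r. 0 < r \<Longrightarrow> (q has_real_derivative p r / r) (at r)"
    and q_cont: "continuous_on {0..} q" and p_cont: "continuous_on {0..} p" and p0: "p 0 = 0"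
  shows "C2_on UNIV u" and "\<And>x. hessian u x = radial_matrix (q (norm x)) (p (norm x)) (sgn x)"
proof -
  have lim_norm: "filterlim (norm :: real^'n \<Rightarrow> real) (at 0 within {0..}) (at 0)"
    by (auto simp: filterlim_at eventually_at_filter intro!: tendsto_norm_zero tendsto_ident_at)
  have u: "(u has_derivative (\<lambda>h. (q (norm x) *\<^sub>R x) \<bullet> h)) (at x)" for x
  proof (cases "x = 0")
    case True
    have "((\<lambda>t. (v t - v 0) / t) \<longlongrightarrow> 0) (at 0 within {0..})"
      using v0 by (simp add: has_field_derivative_iff)
    from tendsto_norm_zero [OF filterlim_compose [OF this lim_norm]]
    have "((\<lambda>h :: real^'n. \<bar>v (norm h) - v 0\<bar> / norm h) \<longlongrightarrow> 0) (at 0)"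
      by simp
    then show ?thesis
      using True by (simp add: has_derivative_at u_def)
  next
    case False
    then show ?thesis
      using has_derivative_radial [OF v False] by (simp add: u_def)
  qed
  then have grad: "gradient u = (\<lambda>x. q (norm x) *\<^sub>R x)"
    using gradient_eqI by blast
  have D: "(gradient u has_derivative
      (\<lambda>h. q (norm x) *\<^sub>R h + (p (norm x) * (sgn x \<bullet> h)) *\<^sub>R sgn x)) (at x)" for x
  proof (cases "x = 0")
    case True
    have "(q \<longlongrightarrow> q 0) (at 0 within {0..})"
      using q_cont by (simp add: continuous_on)
    from filterlim_compose [OF this lim_norm]
    have "((\<lambda>h :: real^'n. q (norm h) - q 0) \<longlongrightarrow> 0) (at 0)"
      using LIM_zero by blast
    from tendsto_norm_zero [OF this]
    \<comment> \<open>The difference quotient of the gradient at 0 is exactly \<open>\<bar>q (norm h) - q 0\<bar>\<close>.\<close>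
    have "((\<lambda>h :: real^'n. norm (q (norm h) *\<^sub>R h - q 0 *\<^sub>R h) / norm h) \<longlongrightarrow> 0) (at 0)"
      by (rule Lim_transform_eventually)
         (auto simp: eventually_at_filter norm_scaleR simp flip: scaleR_left_diff_distrib)
    then show ?thesis
      using True by (simp add: has_derivative_at grad bounded_linear_scaleR_right)
  next
    case False
    then show ?thesis
      using has_derivative_radial_field [OF q False] by (simp add: grad)
  qed
  show hess: "hessian u x = radial_matrix (q (norm x)) (p (norm x)) (sgn x)" for x
    using hessian_eqI [OF D] by (simp add: matrix_radial_matrix)
  have qn: "continuous_on UNIV (\<lambda>x :: real^'n. q (norm x))"
    and pn: "continuous_on UNIV (\<lambda>x :: real^'n. p (norm x))"
    by (auto intro!: continuous_on_compose2 [OF q_cont] continuous_on_compose2 [OF p_cont] continuous_intros)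
  \<comment> \<open>At the origin the bounded, discontinuous factors \<open>sgn x $ i\<close> are absorbed by \<open>p (norm x) \<longlongrightarrow> 0\<close>.\<close>
  have entry: "isCont (\<lambda>x :: real^'n. p (norm x) * sgn x $ i * sgn x $ j) x" for i j x
  proof (cases "x = 0")
    case True
    have lim: "((\<lambda>x :: real^'n. p (norm x)) \<longlongrightarrow> 0) (at 0)"
      using pn [unfolded continuous_on_def, rule_format, of 0] p0 by simp
    have le: "norm (p (norm y) * sgn y $ i * sgn y $ j) \<le> norm (p (norm y))" for y :: "real^'n"
    proof -
      have "\<bar>sgn y $ l\<bar> \<le> 1" for l
        using component_le_norm_cart [of "sgn y" l] by (auto simp: norm_sgn split: if_splits)
      then have "\<bar>sgn y $ i\<bar> * \<bar>sgn y $ j\<bar> \<le> 1"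
        by (intro mult_le_one) auto
      then show ?thesis
        using mult_left_mono [of _ 1 "\<bar>p (norm y)\<bar>"] by (simp add: abs_mult mult.assoc)
    qed
    have "((\<lambda>y. p (norm y) * sgn y $ i * sgn y $ j) \<longlongrightarrow> 0) (at 0)"
      by (rule Lim_null_comparison [OF always_eventually tendsto_norm_zero [OF lim]]) (use le in blast)
    then show ?thesis
      using True p0 by (simp add: isCont_def)
  next
    case False
    have "isCont (\<lambda>x :: real^'n. p (norm x)) x"
      using pn by (simp add: continuous_on_eq_continuous_at)
    moreover have "isCont (\<lambda>x :: real^'n. sgn x $ l) x" for l
      unfolding isCont_def by (intro tendsto_vec_nth tendsto_sgn tendsto_ident_at False)
    ultimately show ?thesis by (intro continuous_mult)
  qed
  have "continuous_on UNIV (\<lambda>x :: real^'n. radial_matrix (q (norm x)) (p (norm x)) (sgn x))"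
    unfolding radial_matrix_def
  proof (intro continuous_on_vec_lambda continuous_on_add)
    fix i j :: 'n
    show "continuous_on UNIV (\<lambda>x :: real^'n. if i = j then q (norm x) else 0)"
      using qn by (cases "i = j") auto
    show "continuous_on UNIV (\<lambda>x :: real^'n. p (norm x) * sgn x $ i * sgn x $ j)"
      using entry by (simp add: continuous_on_eq_continuous_at)
  qed
  then have "continuous_on UNIV (hessian u)"
    unfolding hess [abs_def] by simp
  then show "C2_on UNIV u"
    unfolding C2_on_def by (intro conjI ballI differentiableI [OF u] differentiableI [OF D])
qed

text \<open>
  The profile along a line through the origin is an even function on all of \<open>\<real>\<close>, so its derivative
  vanishes at 0. Away from the origin the gradient is \<open>\<phi> (norm x) / norm x\<close> times \<open>x\<close>, which
  determines the Hessian.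
\<close>
lemma radial_C2_profile:
  fixes u :: "real^'n \<Rightarrow> real"
  assumes "C2_on UNIV u" "radial u" "norm e = 1"
  obtains \<phi> \<phi>' where "\<And>r. ((\<lambda>r. u (r *\<^sub>R e)) has_real_derivative \<phi> r) (at r)"
    and "\<And>r. (\<phi> has_real_derivative \<phi>' r) (at r)" and "\<phi> 0 = 0"
    and "\<And>r. 0 < r \<Longrightarrow> hessian u (r *\<^sub>R e) = radial_matrix (\<phi> r / r) (\<phi>' r - \<phi> r / r) e"
proof -
  define v where "v r = u (r *\<^sub>R e)" for r
  define \<phi> where "\<phi> r = gradient u (r *\<^sub>R e) \<bullet> e" for r
  have line: "((\<lambda>r. r *\<^sub>R e) has_derivative (\<lambda>t. t *\<^sub>R e)) (at r)" for r
    by (intro bounded_linear_imp_has_derivative bounded_linear_scaleR_left)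
  have v: "(v has_real_derivative \<phi> r) (at r)" for r
  proof -
    have "(u has_derivative (\<lambda>h. gradient u (r *\<^sub>R e) \<bullet> h)) (at (r *\<^sub>R e))"
      using assms(1) by (intro has_derivative_gradient) (auto simp: C2_on_def)
    from has_derivative_compose [OF line this] show ?thesis
      by (simp add: has_field_derivative_def v_def [abs_def] \<phi>_def mult_commute_abs)
  qed
  have "\<forall>r. \<exists>d. (\<phi> has_real_derivative d) (at r)"
  proof
    fix r
    have "gradient u differentiable (at (r *\<^sub>R e))"
      using assms(1) by (auto simp: C2_on_def)
    then obtain D where D: "(gradient u has_derivative D) (at (r *\<^sub>R e))"
      by (auto simp: differentiable_def)
    have "((\<lambda>r. gradient u (r *\<^sub>R e) \<bullet> e) has_derivative (\<lambda>t. D (t *\<^sub>R e) \<bullet> e)) (at r)"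
      by (intro has_derivative_inner_left has_derivative_compose [OF line D])
    then have "\<phi> differentiable (at r)"
      unfolding \<phi>_def [abs_def] by (rule differentiableI)
    then show "\<exists>d. (\<phi> has_real_derivative d) (at r)"
      by (simp add: real_differentiable_def)
  qed
  from choice [OF this] obtain \<phi>' where \<phi>': "\<And>r. (\<phi> has_real_derivative \<phi>' r) (at r)"
    by blast
  have radial: "u x = u y" if "norm x = norm y" for x y
    using assms(2) that unfolding radial_def by blast
  have u: "u x = v (norm x)" for x
    unfolding v_def by (rule radial) (simp add: assms(3))
  have grad: "gradient u x = (\<phi> (norm x) / norm x) *\<^sub>R x" if "x \<noteq> 0" for x
  proof -
    have "((\<lambda>x. v (norm x)) has_derivative (\<lambda>h. ((\<phi> (norm x) / norm x) *\<^sub>R x) \<bullet> h)) (at x)"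
      by (rule has_derivative_radial [OF v that])
    then show ?thesis by (intro gradient_eqI) (simp add: u [abs_def])
  qed
  have hess: "hessian u (r *\<^sub>R e) = radial_matrix (\<phi> r / r) (\<phi>' r - \<phi> r / r) e" if "0 < r" for r
  proof -
    let ?x = "r *\<^sub>R e"
    have x: "norm ?x = r" "sgn ?x = e" "?x \<noteq> 0"
      using that assms(3) by (auto simp: sgn_div_norm)
    have "((\<lambda>r. \<phi> r / r) has_real_derivative (\<phi>' r - \<phi> r / r) / r) (at (norm ?x))"
      unfolding x by (rule derivative_eq_intros \<phi>' refl)+ (use that in \<open>auto simp: field_simps\<close>)
    from has_derivative_radial_field [OF this x(3)]
    have "((\<lambda>y. (\<phi> (norm y) / norm y) *\<^sub>R y) has_derivative
        (\<lambda>h. (\<phi> r / r) *\<^sub>R h + ((\<phi>' r - \<phi> r / r) * (e \<bullet> h)) *\<^sub>R e)) (at ?x)"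
      using that assms(3) by (simp add: x)
    then have "(gradient u has_derivative
        (\<lambda>h. (\<phi> r / r) *\<^sub>R h + ((\<phi>' r - \<phi> r / r) * (e \<bullet> h)) *\<^sub>R e)) (at ?x)"
      by (rule has_derivative_transform_within_open [of _ _ _ _ "- {0}"]) (use x grad in auto)
    from hessian_eqI [OF this] show ?thesis
      by (simp only: matrix_radial_matrix)
  qed
  have "\<phi> 0 = 0"
  proof -
    have "((\<lambda>r. v (- r)) has_real_derivative - \<phi> 0) (at 0)"
      by (rule DERIV_chain' [where f = uminus and g = v, THEN DERIV_cong]) (auto intro!: derivative_eq_intros v)
    moreover have "(\<lambda>r. v (- r)) = v"
      unfolding v_def by (intro ext radial) simp
    ultimately have "- \<phi> 0 = \<phi> 0"
      using v [of 0] DERIV_unique by metis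
    then show ?thesis by simp
  qed
  with that [of \<phi> \<phi>'] v \<phi>' hess show thesis by (simp add: v_def [abs_def])
qed

section \<open>Weighted radial means\<close>

text \<open>
  For \<open>t > 0\<close> and up to the factor \<open>n\<close>, this is the mean over the ball of radius \<open>t\<close> in dimension
  \<open>n\<close> of the radial function with profile \<open>g\<close> (see \<open>radial_mean_eq_integral\<close>). Integrating over the
  fixed interval \<open>{0..1}\<close> removes the singular factor \<open>t powi (- n)\<close>, so that continuity at
  \<open>t = 0\<close> is a property of parameter integrals.
\<close>
definition radial_mean :: "nat \<Rightarrow> (real \<Rightarrow> real) \<Rightarrow> real \<Rightarrow> real" where
  "radial_mean n g t = integral {0..1} (\<lambda>s. s ^ (n - 1) * g (t * s))"

lemma radial_mean_integrable:
  fixes g :: "real \<Rightarrow> real"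
  assumes "continuous_on {0..} g" "0 \<le> t"
  shows "(\<lambda>s. s ^ (n - 1) * g (t * s)) integrable_on {0..1}"
  by (rule integrable_continuous_real, intro continuous_intros continuous_on_compose2 [OF assms(1)])
     (use assms(2) in auto)

lemma continuous_on_radial_mean:
  assumes "continuous_on {0..} g"
  shows "continuous_on {0..} (radial_mean n g)"
proof -
  have "continuous_on ({0..} \<times> cbox 0 1) (\<lambda>(t, s). s ^ (n - 1) * g (t * s))"
    unfolding split_def
    by (intro continuous_intros continuous_on_compose2 [OF assms]) auto
  from integral_continuous_on_param [OF this] show ?thesis
    by (simp add: radial_mean_def [abs_def])
qed

lemma radial_mean_eq_integral:
  assumes "continuous_on {0..} g" "0 \<le> t" "1 \<le> n"
  shows "t ^ n * radial_mean n g t = integral {0..t} (\<lambda>s. s ^ (n - 1) * g s)"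
proof (cases "t = 0")
  case False
  with assms(2) have t: "0 < t" by simp
  have "continuous_on {0..t} (\<lambda>s. s ^ (n - 1) * g s)"
    by (intro continuous_intros continuous_on_subset [OF assms(1)]) auto
  then have "((\<lambda>s. s ^ (n - 1) * g s) has_integral integral {0..t} (\<lambda>s. s ^ (n - 1) * g s)) {0..t}"
    by (intro integrable_integral integrable_continuous_real)
  from has_integral_stretch_real [OF this False]
  have "((\<lambda>s. t ^ (n - 1) * (s ^ (n - 1) * g (t * s))) has_integral
      integral {0..t} (\<lambda>s. s ^ (n - 1) * g s) / t) {0..1}"
    using t by (simp add: power_mult_distrib mult.assoc)
  moreover have "((\<lambda>s. t ^ (n - 1) * (s ^ (n - 1) * g (t * s))) has_integral
      t ^ (n - 1) * radial_mean n g t) {0..1}"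
    unfolding radial_mean_def
    by (intro has_integral_mult_right integrable_integral radial_mean_integrable assms)
  ultimately have "t ^ (n - 1) * radial_mean n g t = integral {0..t} (\<lambda>s. s ^ (n - 1) * g s) / t"
    by (rule has_integral_unique [symmetric])
  moreover have "t ^ n = t * t ^ (n - 1)"
    using assms(3) by (cases n) auto
  ultimately show ?thesis
    using t by (simp add: field_simps)
qed (use assms(3) in auto)

lemma radial_mean_mono:
  assumes "continuous_on {0..} g" "continuous_on {0..} h" "0 \<le> t"
    and "\<And>s. 0 \<le> s \<Longrightarrow> s \<le> t \<Longrightarrow> g s \<le> h s"
  shows "radial_mean n g t \<le> radial_mean n h t"
  unfolding radial_mean_def
proof (intro integral_le radial_mean_integrable assms)
  fix s :: real assume "s \<in> {0..1}"
  then show "s ^ (n - 1) * g (t * s) \<le> s ^ (n - 1) * h (t * s)"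
    using assms(3) by (intro mult_left_mono assms(4)) (auto simp: mult_left_le)
qed

lemma radial_mean_const:
  assumes "1 \<le> n"
  shows "radial_mean n (\<lambda>_. a) t = a / real n"
proof -
  have "((\<lambda>s. s ^ (n - 1) * a) has_integral (1 ^ n * a / real n - 0 ^ n * a / real n)) {0..1}"
    by (rule fundamental_theorem_of_calculus)
       (use assms in \<open>auto intro!: derivative_eq_intros
          simp flip: has_real_derivative_iff_has_vector_derivative\<close>)
  from integral_unique [OF this] show ?thesis
    using assms unfolding radial_mean_def by simp
qed

lemma radial_mean_0:
  assumes "1 \<le> n"
  shows "radial_mean n g 0 = g 0 / real n"
  using radial_mean_const [OF assms, of "g 0" 0] by (simp add: radial_mean_def)

lemma radial_mean_pos:
  assumes "continuous_on {0..} g" "\<And>s. 0 \<le> s \<Longrightarrow> 0 < g s" "0 \<le> t" "1 \<le> n"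
  shows "0 < radial_mean n g t"
proof -
  have "continuous_on {0..t} g"
    by (rule continuous_on_subset [OF assms(1)]) auto
  then obtain x where x: "x \<in> {0..t}" "\<forall>y\<in>{0..t}. g x \<le> g y"
    using continuous_attains_inf [of "{0..t}" g] assms(3) by auto
  have "0 < g x / real n"
    using assms(2,4) x(1) by simp
  also have "\<dots> = radial_mean n (\<lambda>_. g x) t"
    using radial_mean_const [OF assms(4)] by simp
  also have "\<dots> \<le> radial_mean n g t"
    using x by (intro radial_mean_mono assms) auto
  finally show ?thesis .
qed

lemma radial_mean_mult_left: "radial_mean n (\<lambda>s. a * g s) t = a * radial_mean n g t"
  unfolding radial_mean_def by (simp add: mult.left_commute)

text \<open>
  Here the form \<open>t powi (- n)\<close> times an indefinite integral is the convenient one. After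
  multiplication by \<open>t\<close> the derivative extends continuously by 0 to \<open>t = 0\<close>, by \<open>radial_mean_0\<close>.
\<close>
lemma radial_mean_has_derivative:
  assumes "continuous_on {0..} g" "0 < t" "1 \<le> n"
  shows "(radial_mean n g has_real_derivative (g t - real n * radial_mean n g t) / t) (at t)"
proof -
  let ?I = "\<lambda>t. integral {0..t} (\<lambda>s. s ^ (n - 1) * g s)"
  have "continuous_on {0..t + 1} (\<lambda>s. s ^ (n - 1) * g s)"
    by (intro continuous_intros continuous_on_subset [OF assms(1)]) auto
  from integral_has_real_derivative [OF this, of t]
  have "(?I has_real_derivative t ^ (n - 1) * g t) (at t within {0..t + 1})"
    using assms(2) by auto
  then have I: "(?I has_real_derivative t ^ (n - 1) * g t) (at t)"
    using at_within_Icc_at [of 0 t "t + 1"] assms(2) by simp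
  have eq: "?I t = t ^ n * radial_mean n g t" if "0 \<le> t" for t
    using radial_mean_eq_integral assms(1,3) that by simp
  have tn: "t ^ n = t * t ^ (n - 1)"
    using assms(3) by (cases n) auto
  have "((\<lambda>t. ?I t / t ^ n) has_real_derivative
      (t ^ (n - 1) * g t * t ^ n - ?I t * (real n * t ^ (n - 1))) / (t ^ n * t ^ n)) (at t)"
    by (rule DERIV_divide [OF I]) (use assms(2) in \<open>auto intro!: derivative_eq_intros\<close>)
  also have "(t ^ (n - 1) * g t * t ^ n - ?I t * (real n * t ^ (n - 1))) / (t ^ n * t ^ n)
      = (g t - real n * radial_mean n g t) / t"
    unfolding eq [OF less_imp_le [OF assms(2)]] using assms(2) by (simp add: tn field_simps)
  finally have "((\<lambda>t. ?I t / t ^ n) has_real_derivative (g t - real n * radial_mean n g t) / t) (at t)" .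
  then show ?thesis
    by (rule has_field_derivative_transform_within_open [of _ _ _ "{0<..}"]) (use assms(2) eq in auto)
qed

lemma radial_mean_tendsto:
  assumes "\<And>m. continuous_on {0..} (g m)" "continuous_on {0..} h" "0 \<le> t"
    and "\<And>s. 0 \<le> s \<Longrightarrow> (\<lambda>m. g m s) \<longlonglongrightarrow> l s"
    and "\<And>m s. 0 \<le> s \<Longrightarrow> \<bar>g m s\<bar> \<le> h s"
  shows "(\<lambda>m. radial_mean n (g m) t) \<longlonglongrightarrow> radial_mean n l t"
  unfolding radial_mean_def
proof (rule dominated_convergence(2))
  show "(\<lambda>s. s ^ (n - 1) * h (t * s)) integrable_on {0..1}"
    by (rule radial_mean_integrable) fact+
  show "(\<lambda>s. s ^ (n - 1) * g m (t * s)) integrable_on {0..1}" for m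
    by (rule radial_mean_integrable) fact+
  show "norm (s ^ (n - 1) * g m (t * s)) \<le> s ^ (n - 1) * h (t * s)" if "s \<in> {0..1}" for m s
    using that assms(3) by (auto simp: abs_mult intro!: mult_left_mono assms(5))
  show "(\<lambda>m. s ^ (n - 1) * g m (t * s)) \<longlonglongrightarrow> s ^ (n - 1) * l (t * s)" if "s \<in> {0..1}" for s
    using that assms(3) by (intro tendsto_mult tendsto_const assms(4)) auto
qed

section \<open>The radial equation\<close>

text \<open>
  The ordinary differential equation for the profile. In the application \<open>n\<close> is the dimension,
  \<open>c = n / (n choose k)\<close>, and \<open>\<beta>\<close> is the profile of the coefficient \<open>b\<close>.
\<close>
locale radial_problem =
  fixes n k :: nat and c \<gamma> :: real and \<beta> :: "real \<Rightarrow> real"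
  assumes n: "1 \<le> n" and k: "1 \<le> k" and c: "0 < c" and \<gamma>: "0 < \<gamma>" "\<gamma> < real k"
    and \<beta>_cont: "continuous_on {0..} \<beta>" and \<beta>_pos: "\<And>r. 0 \<le> r \<Longrightarrow> 0 < \<beta> r"
begin

definition source :: "(real \<Rightarrow> real) \<Rightarrow> real \<Rightarrow> real" where
  "source w s = \<beta> s * w s powr \<gamma>"

text \<open>
  The integrated equation prescribes this value for \<open>v' t / t\<close>, the eigenvalue of the Hessian in
  the directions orthogonal to \<open>x\<close>.
\<close>
definition curvature :: "(real \<Rightarrow> real) \<Rightarrow> real \<Rightarrow> real" where
  "curvature w t = (c * radial_mean n (source w) t) powr (1 / real k)"

definition slope :: "(real \<Rightarrow> real) \<Rightarrow> real \<Rightarrow> real" where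
  "slope w t = t * curvature w t"

definition profile :: "(real \<Rightarrow> real) \<Rightarrow> bool" where
  "profile w \<longleftrightarrow> continuous_on {0..} w \<and> (\<forall>r\<ge>0. 0 < w r)"

lemma profileD: "profile w \<Longrightarrow> continuous_on {0..} w" "profile w \<Longrightarrow> 0 \<le> r \<Longrightarrow> 0 < w r"
  by (auto simp: profile_def)

lemma profile_const: "profile (\<lambda>_. 1)"
  by (simp add: profile_def)

lemma source_cont: "profile w \<Longrightarrow> continuous_on {0..} (source w)"
  unfolding source_def [abs_def]
  by (intro continuous_intros \<beta>_cont profileD) (auto dest: profileD(2))

lemma source_pos: "profile w \<Longrightarrow> 0 \<le> s \<Longrightarrow> 0 < source w s"
  using profileD(2) [of w s] \<beta>_pos [of s] by (simp add: source_def)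

lemma mean_source_pos: "profile w \<Longrightarrow> 0 \<le> t \<Longrightarrow> 0 < radial_mean n (source w) t"
  by (intro radial_mean_pos source_cont source_pos n)

lemma curvature_pos: "profile w \<Longrightarrow> 0 \<le> t \<Longrightarrow> 0 < curvature w t"
  using mean_source_pos [of w t] c by (simp add: curvature_def)

lemma curvature_power:
  assumes "profile w" "0 \<le> t"
  shows "curvature w t ^ k = c * radial_mean n (source w) t"
proof -
  have "curvature w t ^ k = curvature w t powr real k"
    using curvature_pos [OF assms] by (simp add: powr_realpow)
  then show ?thesis
    using k c mean_source_pos [OF assms] by (simp add: curvature_def powr_powr)
qed

lemma curvature_cont: "profile w \<Longrightarrow> continuous_on {0..} (curvature w)"
  unfolding curvature_def [abs_def]
  by (intro continuous_intros continuous_on_radial_mean source_cont)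
     (use c mean_source_pos in \<open>auto simp: less_le\<close>)

lemma slope_cont: "profile w \<Longrightarrow> continuous_on {0..} (slope w)"
  unfolding slope_def [abs_def] by (intro continuous_intros curvature_cont)

lemma slope_nonneg: "0 \<le> t \<Longrightarrow> 0 \<le> slope w t"
  by (simp add: slope_def curvature_def)

lemma slope_integrable: "profile w \<Longrightarrow> 0 \<le> s \<Longrightarrow> slope w integrable_on {s..r}"
  by (rule integrable_continuous_real, rule continuous_on_subset [OF slope_cont]) auto

lemma slope_mono:
  assumes "profile w" "profile z" "0 \<le> t" "\<And>s. 0 \<le> s \<Longrightarrow> s \<le> t \<Longrightarrow> w s \<le> z s"
  shows "slope w t \<le> slope z t"
proof -
  have "radial_mean n (source w) t \<le> radial_mean n (source z) t"
  proof (intro radial_mean_mono source_cont assms)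
    fix s assume s: "0 \<le> s" "s \<le> t"
    then show "source w s \<le> source z s"
      unfolding source_def using assms(4) profileD(2) [OF assms(1)] \<beta>_pos \<gamma>
      by (intro mult_left_mono powr_mono2) (auto intro: less_imp_le)
  qed
  then show ?thesis
    unfolding slope_def curvature_def using assms(3) c mean_source_pos [OF assms(1,3)]
    by (intro mult_left_mono powr_mono2) auto
qed

text \<open>
  For a profile that is largest at the right end point, \<open>w s powr \<gamma>\<close> can be pulled out of the mean
  as \<open>w t powr \<gamma>\<close>. The resulting bound makes the nonlocal equation comparable with a separable one.
\<close>
lemma slope_le:
  assumes "profile w" "0 \<le> t" "\<And>s. 0 \<le> s \<Longrightarrow> s \<le> t \<Longrightarrow> w s \<le> w t"
  shows "slope w t \<le> w t powr (\<gamma> / real k) * slope (\<lambda>_. 1) t"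
proof -
  have src1: "source (\<lambda>_. 1) = \<beta>"
    by (simp add: source_def [abs_def])
  have "radial_mean n (source w) t \<le> radial_mean n (\<lambda>s. w t powr \<gamma> * \<beta> s) t"
  proof (intro radial_mean_mono source_cont assms)
    show "continuous_on {0..} (\<lambda>s. w t powr \<gamma> * \<beta> s)"
      by (intro continuous_intros \<beta>_cont)
    fix s assume s: "0 \<le> s" "s \<le> t"
    have "w s powr \<gamma> \<le> w t powr \<gamma>"
      using assms(3) [OF s] profileD(2) [OF assms(1) s(1)] \<gamma> by (intro powr_mono2) auto
    then show "source w s \<le> w t powr \<gamma> * \<beta> s"
      using \<beta>_pos [OF s(1)] by (simp add: source_def mult.commute)
  qed
  also have "\<dots> = w t powr \<gamma> * radial_mean n \<beta> t"
    by (rule radial_mean_mult_left)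
  finally have "curvature w t \<le> (w t powr \<gamma> * (c * radial_mean n \<beta> t)) powr (1 / real k)"
    unfolding curvature_def using c mean_source_pos [OF assms(1,2)]
    by (intro powr_mono2) (auto simp: mult.left_commute)
  also have "\<dots> = w t powr (\<gamma> / real k) * curvature (\<lambda>_. 1) t"
    using c mean_source_pos [OF profile_const assms(2)]
    by (simp add: curvature_def powr_mult powr_powr src1)
  finally show ?thesis
    using assms(2) by (simp add: slope_def mult.left_commute mult_left_mono)
qed

text \<open>
  The difference \<open>p\<close> between the radial and the tangential eigenvalue of the Hessian: it is
  \<open>t\<close> times the derivative of \<open>curvature w\<close>, but written without derivatives so that it makes sense
  and is continuous at \<open>t = 0\<close>.
\<close>
definition anisotropy :: "(real \<Rightarrow> real) \<Rightarrow> real \<Rightarrow> real" where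
  "anisotropy w t = (c * source w t - real n * curvature w t ^ k) / (real k * curvature w t ^ (k - 1))"

lemma anisotropy_eq:
  assumes "profile w" "0 \<le> t"
  shows "curvature w t ^ (k - 1) * (real k * anisotropy w t + real n * curvature w t) = c * source w t"
proof -
  have "curvature w t ^ k = curvature w t * curvature w t ^ (k - 1)"
    using k by (cases k) auto
  then show ?thesis
    using curvature_pos [OF assms] k by (simp add: anisotropy_def field_simps)
qed

lemma anisotropy_cont: "profile w \<Longrightarrow> continuous_on {0..} (anisotropy w)"
  unfolding anisotropy_def [abs_def]
  by (intro continuous_intros source_cont curvature_cont)
     (use k curvature_pos in \<open>auto simp: less_le\<close>)

text \<open>
  At the origin the mean of \<open>source w\<close> is \<open>source w 0 / n\<close>, which balances the numerator.
\<close>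
lemma anisotropy_0: "profile w \<Longrightarrow> anisotropy w 0 = 0"
  using n by (simp add: anisotropy_def curvature_power radial_mean_0)

lemma curvature_has_derivative:
  assumes "profile w" "0 < t"
  shows "(curvature w has_real_derivative anisotropy w t / t) (at t)"
proof -
  let ?M = "radial_mean n (source w)"
  let ?q = "curvature w t"
  have t: "0 \<le> t" using assms(2) by simp
  note pos = curvature_pos [OF assms(1) t] mean_source_pos [OF assms(1) t]
  have M: "((\<lambda>t. c * ?M t) has_real_derivative c * ((source w t - real n * ?M t) / t)) (at t)"
    by (intro DERIV_cmult radial_mean_has_derivative source_cont assms n)
  have "0 < c * ?M t"
    using pos c by simp
  then have "((\<lambda>t. (c * ?M t) powr (1 / real k)) has_real_derivative
      1 / real k * (c * ?M t) powr (1 / real k - 1) * (c * ((source w t - real n * ?M t) / t))) (at t)"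
    by (rule DERIV_chain' [OF M has_real_derivative_powr])
  also have "(c * ?M t) powr (1 / real k - 1) = ?q / ?q ^ k"
    using pos c by (simp add: powr_diff curvature_power [OF assms(1) t]) (simp add: curvature_def)
  also have "1 / real k * (?q / ?q ^ k) * (c * ((source w t - real n * ?M t) / t)) = anisotropy w t / t"
  proof -
    have "c * (source w t - real n * ?M t) = c * source w t - real n * ?q ^ k"
      by (simp add: curvature_power [OF assms(1) t] algebra_simps)
    moreover have "?q / ?q ^ k = 1 / ?q ^ (k - 1)"
      using k pos by (cases k) auto
    ultimately show ?thesis
      by (simp add: anisotropy_def)
  qed
  finally show ?thesis
    by (simp add: curvature_def [abs_def])
qed

lemma fixed_profile_has_derivative:
  assumes "profile v" "\<And>r. 0 \<le> r \<Longrightarrow> v r = 1 + integral {0..r} (slope v)"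
  shows "0 \<le> r \<Longrightarrow> (v has_real_derivative slope v r) (at r within {0..})"
proof -
  assume r: "0 \<le> r"
  have "((\<lambda>r. 1 + integral {0..r} (slope v)) has_real_derivative slope v r) (at r within {0..r + 1})"
    using integral_has_real_derivative [OF continuous_on_subset [OF slope_cont [OF assms(1)]], of 0 "r + 1" r] r
    by (auto intro!: derivative_eq_intros)
  moreover have "at r within {0..r + 1} = at r within {0..}"
    by (rule at_within_nhd [of _ "{..<r + 1}"]) auto
  ultimately have "((\<lambda>r. 1 + integral {0..r} (slope v)) has_real_derivative slope v r) (at r within {0..})"
    by simp
  then show ?thesis
    by (rule has_field_derivative_transform_within [of _ _ _ _ 1]) (use r assms(2) in auto)
qed

text \<open>
  The integrand of the divergence criterion is the slope of the constant profile. At \<open>r = 0\<close> both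
  sides vanish because the integral is over a single point, whatever value the power of \<open>r\<close> has.
\<close>
lemma slope_one_eq:
  assumes "0 \<le> r" "k \<le> n" "0 < C" "c = real n / C"
  shows "(real n * r powi (int k - int n) / C * integral {0..r} (\<lambda>s. s ^ (n - 1) * \<beta> s)) powr (1 / real k)
    = slope (\<lambda>_. 1) r"
proof (cases "r = 0")
  case False
  with assms(1) have r: "0 < r" by simp
  have src1: "source (\<lambda>_. 1) = \<beta>"
    by (simp add: source_def [abs_def])
  have "r powi (int k - int n) * r ^ n = r ^ k"
    using r by (simp add: power_int_diff)
  moreover have "integral {0..r} (\<lambda>s. s ^ (n - 1) * \<beta> s) = r ^ n * radial_mean n \<beta> r"
    by (rule radial_mean_eq_integral [OF \<beta>_cont assms(1) n, symmetric])
  ultimately have "real n * r powi (int k - int n) / C * integral {0..r} (\<lambda>s. s ^ (n - 1) * \<beta> s)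
      = r ^ k * (c * radial_mean n \<beta> r)"
    using assms(3,4) by (simp add: field_simps)
  also have "\<dots> powr (1 / real k) = r * (c * radial_mean n \<beta> r) powr (1 / real k)"
    using r k c mean_source_pos [OF profile_const assms(1)]
    by (simp add: powr_mult powr_powr src1 flip: powr_realpow)
  finally show ?thesis
    by (simp add: slope_def curvature_def src1)
qed (simp add: slope_def)

section \<open>Global solutions of the radial equation\<close>

text \<open>
  The solution of the separable equation \<open>V' = V powr (\<gamma> / k) * slope 1\<close> with \<open>V 0 = 1\<close>.
  The hypothesis \<open>\<gamma> < k\<close> makes the exponents positive, so \<open>V\<close> does not blow up.
\<close>
definition barrier :: "real \<Rightarrow> real" where
  "barrier r = (1 + (1 - \<gamma> / real k) * integral {0..r} (slope (\<lambda>_. 1))) powr (1 / (1 - \<gamma> / real k))"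

lemma exponent: "0 < 1 - \<gamma> / real k"
  using k \<gamma> by simp

lemma barrier_base: "1 \<le> 1 + (1 - \<gamma> / real k) * integral {0..r} (slope (\<lambda>_. 1))" if "0 \<le> r"
  using exponent slope_nonneg slope_integrable [OF profile_const, of 0 r]
  by (auto intro!: mult_nonneg_nonneg integral_nonneg)

lemma barrier_has_derivative:
  assumes "r \<in> {0..R}"
  shows "(barrier has_real_derivative barrier r powr (\<gamma> / real k) * slope (\<lambda>_. 1) r) (at r within {0..R})"
proof -
  let ?\<theta> = "1 - \<gamma> / real k"
  let ?B = "\<lambda>r. 1 + ?\<theta> * integral {0..r} (slope (\<lambda>_. 1))"
  have "((\<lambda>r. integral {0..r} (slope (\<lambda>_. 1))) has_real_derivative slope (\<lambda>_. 1) r) (at r within {0..R})"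
    by (rule integral_has_real_derivative [OF continuous_on_subset [OF slope_cont [OF profile_const]] assms]) auto
  then have B: "(?B has_real_derivative ?\<theta> * slope (\<lambda>_. 1) r) (at r within {0..R})"
    by (auto intro!: derivative_eq_intros)
  have pos: "0 < ?B r"
    using barrier_base [of r] assms by auto
  have "((\<lambda>r. ?B r powr (1 / ?\<theta>)) has_real_derivative
      (1 / ?\<theta> * ?B r powr (1 / ?\<theta> - 1)) * (?\<theta> * slope (\<lambda>_. 1) r)) (at r within {0..R})"
    by (rule DERIV_chain' [OF B has_real_derivative_powr [OF pos]])
  also have "1 / ?\<theta> - 1 = 1 / ?\<theta> * (\<gamma> / real k)"
    using k \<gamma> by (simp add: divide_simps)
  also have "(1 / ?\<theta> * ?B r powr (1 / ?\<theta> * (\<gamma> / real k))) * (?\<theta> * slope (\<lambda>_. 1) r)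
      = barrier r powr (\<gamma> / real k) * slope (\<lambda>_. 1) r"
    using k \<gamma> by (simp add: barrier_def powr_powr)
  finally show ?thesis
    by (simp add: barrier_def [abs_def])
qed

lemma barrier_cont: "continuous_on {0..} barrier"
proof -
  have "continuous (at r within {0..}) barrier" if "0 \<le> r" for r
  proof -
    have "continuous (at r within {0..r + 1}) barrier"
      using that by (intro DERIV_continuous [OF barrier_has_derivative]) auto
    moreover have "at r within {0..r + 1} = at r within {0..}"
      by (rule at_within_nhd [of _ "{..<r + 1}"]) auto
    ultimately show ?thesis by (simp add: continuous_within)
  qed
  then show ?thesis
    by (simp add: continuous_on_eq_continuous_within)
qed

lemma barrier_0: "barrier 0 = 1"
  by (simp add: barrier_def)

lemma barrier_has_integral:
  assumes "0 \<le> s" "s \<le> r"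
  shows "((\<lambda>t. barrier t powr (\<gamma> / real k) * slope (\<lambda>_. 1) t) has_integral barrier r - barrier s) {s..r}"
proof (rule fundamental_theorem_of_calculus [OF assms(2)])
  fix t assume t: "t \<in> {s..r}"
  have "(barrier has_real_derivative barrier t powr (\<gamma> / real k) * slope (\<lambda>_. 1) t) (at t within {s..r})"
    by (rule has_field_derivative_subset [OF barrier_has_derivative [of t r]]) (use assms t in auto)
  then show "(barrier has_vector_derivative barrier t powr (\<gamma> / real k) * slope (\<lambda>_. 1) t) (at t within {s..r})"
    by (simp add: has_real_derivative_iff_has_vector_derivative)
qed

lemma barrier_mono:
  assumes "0 \<le> s" "s \<le> r"
  shows "barrier s \<le> barrier r"
proof -
  have "0 \<le> barrier r - barrier s"
    by (rule has_integral_nonneg [OF barrier_has_integral [OF assms]])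
       (use assms slope_nonneg in auto)
  then show ?thesis by simp
qed

text \<open>The order interval in which the iteration takes place.\<close>
definition trapped :: "(real \<Rightarrow> real) \<Rightarrow> bool" where
  "trapped w \<longleftrightarrow> continuous_on {0..} w \<and> (\<forall>r\<ge>0. 1 \<le> w r \<and> w r \<le> barrier r)"

lemma trapped_profile: "trapped w \<Longrightarrow> profile w"
  unfolding trapped_def profile_def by force

lemma trapped_barrier: "trapped barrier"
  using barrier_cont barrier_mono [of 0] by (simp add: trapped_def barrier_0)

definition shoot :: "(real \<Rightarrow> real) \<Rightarrow> real \<Rightarrow> real" where
  "shoot w r = 1 + integral {0..r} (slope w)"

lemma shoot_diff:
  assumes "profile w" "0 \<le> s" "s \<le> r"
  shows "shoot w r - shoot w s = integral {s..r} (slope w)"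
  using Henstock_Kurzweil_Integration.integral_combine [OF assms(2,3) slope_integrable [OF assms(1) order_refl]]
  by (simp add: shoot_def)

text \<open>
  Comparison of the slopes, \<open>slope w \<le> slope barrier \<le> barrier'\<close>, bounds increments and not only
  values. From \<open>s = 0\<close> it follows that \<open>shoot\<close> preserves the order interval; for general \<open>s\<close> it
  yields a common modulus of continuity of the iterates.
\<close>
lemma shoot_increment:
  assumes "trapped w" "0 \<le> s" "s \<le> r"
  shows "shoot w s \<le> shoot w r" and "shoot w r - shoot w s \<le> barrier r - barrier s"
proof -
  note w = trapped_profile [OF assms(1)]
  have "0 \<le> integral {s..r} (slope w)"
    by (intro integral_nonneg slope_integrable w assms slope_nonneg) (use assms in auto)
  then show "shoot w s \<le> shoot w r"
    using shoot_diff [OF w assms(2,3)] by simp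
  have "integral {s..r} (slope w) \<le> barrier r - barrier s"
  proof (rule has_integral_le [OF integrable_integral [OF slope_integrable [OF w assms(2)]]
        barrier_has_integral [OF assms(2,3)]])
    fix t assume "t \<in> {s..r}"
    then have t: "0 \<le> t" using assms by auto
    have "slope w t \<le> slope barrier t"
      using assms(1) t by (intro slope_mono w trapped_profile trapped_barrier) (auto simp: trapped_def)
    also have "\<dots> \<le> barrier t powr (\<gamma> / real k) * slope (\<lambda>_. 1) t"
      using t by (intro slope_le trapped_profile trapped_barrier barrier_mono)
    finally show "slope w t \<le> barrier t powr (\<gamma> / real k) * slope (\<lambda>_. 1) t" .
  qed
  then show "shoot w r - shoot w s \<le> barrier r - barrier s"
    using shoot_diff [OF w assms(2,3)] by simp
qed

text \<open>
  The bound on increments passes to pointwise limits, so this gives continuity of the limit of the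
  iteration, which pointwise monotone convergence alone does not.
\<close>
lemma increment_cont:
  assumes "\<And>s r. 0 \<le> s \<Longrightarrow> s \<le> r \<Longrightarrow> w s \<le> w r \<and> w r - w s \<le> barrier r - barrier s"
  shows "continuous_on {0..} w"
proof -
  have dist: "dist (w s) (w r) \<le> dist (barrier s) (barrier r)" if "0 \<le> s" "0 \<le> r" for s r
    using assms [of s r] assms [of r s] that by (cases "s \<le> r") (auto simp: dist_real_def)
  show ?thesis
    unfolding continuous_on_iff
  proof (intro ballI allI impI)
    fix x e :: real assume x: "x \<in> {0..}" and e: "0 < e"
    obtain d where "0 < d" "\<And>y. y \<in> {0..} \<Longrightarrow> dist y x < d \<Longrightarrow> dist (barrier y) (barrier x) < e"
      using barrier_cont x e unfolding continuous_on_iff by metis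
    then show "\<exists>d>0. \<forall>y\<in>{0..}. dist y x < d \<longrightarrow> dist (w y) (w x) < e"
      using dist x by (meson atLeast_iff le_less_trans)
  qed
qed

lemma shoot_0: "shoot w 0 = 1"
  by (simp add: shoot_def)

lemma trapped_shoot:
  assumes "trapped w"
  shows "trapped (shoot w)"
proof -
  have "1 \<le> shoot w r \<and> shoot w r \<le> barrier r" if "0 \<le> r" for r
    using shoot_increment [OF assms order_refl that] by (simp add: shoot_0 barrier_0)
  moreover have "continuous_on {0..} (shoot w)"
    using shoot_increment [OF assms] by (intro increment_cont) auto
  ultimately show ?thesis by (simp add: trapped_def)
qed

lemma shoot_mono:
  assumes "trapped w" "trapped z" "\<And>s. 0 \<le> s \<Longrightarrow> w s \<le> z s" "0 \<le> r"
  shows "shoot w r \<le> shoot z r"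
  unfolding shoot_def
  using assms by (intro add_left_mono integral_le slope_integrable slope_mono trapped_profile) auto

definition iterate :: "nat \<Rightarrow> real \<Rightarrow> real" where
  "iterate m = (shoot ^^ m) (\<lambda>_. 1)"

lemma iterate_Suc: "iterate (Suc m) = shoot (iterate m)"
  by (simp add: iterate_def)

lemma trapped_iterate: "trapped (iterate m)"
proof (induction m)
  case 0
  show ?case
    using barrier_mono [of 0] by (simp add: iterate_def trapped_def barrier_0)
qed (simp add: iterate_Suc trapped_shoot)

lemma iterate_mono: "0 \<le> r \<Longrightarrow> iterate m r \<le> iterate (Suc m) r"
proof (induction m arbitrary: r)
  case 0
  have "1 \<le> iterate (Suc 0) r"
    using trapped_iterate [of "Suc 0"] 0 unfolding trapped_def by blast
  then show ?case by (simp add: iterate_def)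
next
  case (Suc m)
  then show ?case
    unfolding iterate_Suc [of m] iterate_Suc [of "Suc m"] by (intro shoot_mono trapped_shoot trapped_iterate) auto
qed

lemma iterate_increment:
  assumes "0 \<le> s" "s \<le> r"
  shows "iterate m s \<le> iterate m r \<and> iterate m r - iterate m s \<le> barrier r - barrier s"
proof (cases m)
  case 0
  then show ?thesis using barrier_mono [OF assms] by (simp add: iterate_def)
next
  case (Suc j)
  then show ?thesis using shoot_increment [OF trapped_iterate assms] by (simp add: iterate_Suc)
qed

text \<open>
  The iterates increase and are bounded by the barrier, so they converge pointwise. Dominated
  convergence is used twice: under the mean for the slopes, and then under the integral of the
  slopes.
\<close>
lemma exists_global_profile:
  obtains v where "profile v" "\<And>s r. 0 \<le> s \<Longrightarrow> s \<le> r \<Longrightarrow> v s \<le> v r"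
    and "\<And>r. 0 \<le> r \<Longrightarrow> 1 \<le> v r" and "\<And>r. 0 \<le> r \<Longrightarrow> v r = 1 + integral {0..r} (slope v)"
proof -
  have bounds: "1 \<le> iterate m r" "iterate m r \<le> barrier r" if "0 \<le> r" for m r
    using trapped_iterate [of m] that by (auto simp: trapped_def)
  have "\<exists>l. (\<lambda>m. iterate m r) \<longlonglongrightarrow> l" if "0 \<le> r" for r
    using incseq_convergent [of "\<lambda>m. iterate m r" "barrier r"] bounds iterate_mono that
    by (metis incseq_SucI)
  then obtain v where lim: "\<And>r. 0 \<le> r \<Longrightarrow> (\<lambda>m. iterate m r) \<longlonglongrightarrow> v r"
    by metis
  have inc: "v s \<le> v r \<and> v r - v s \<le> barrier r - barrier s" if "0 \<le> s" "s \<le> r" for s r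
  proof
    show "v s \<le> v r"
      by (rule LIMSEQ_le [OF lim lim]) (use that iterate_increment in auto)
    have "(\<lambda>m. iterate m r - iterate m s) \<longlonglongrightarrow> v r - v s"
      by (intro tendsto_diff lim) (use that in auto)
    then show "v r - v s \<le> barrier r - barrier s"
      by (rule LIMSEQ_le_const2) (use that iterate_increment in auto)
  qed
  have ge1: "1 \<le> v r" and le_barrier: "v r \<le> barrier r" if "0 \<le> r" for r
    using LIMSEQ_le_const [OF lim [OF that]] LIMSEQ_le_const2 [OF lim [OF that]] bounds [OF that] by blast+
  have trap: "trapped v"
    using increment_cont [OF inc] ge1 le_barrier by (simp add: trapped_def)
  have src: "(\<lambda>m. source (iterate m) s) \<longlonglongrightarrow> source v s" if "0 \<le> s" for s
    unfolding source_def using ge1 [OF that]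
    by (intro tendsto_mult tendsto_const tendsto_powr lim that) auto
  have slope_lim: "(\<lambda>m. slope (iterate m) t) \<longlonglongrightarrow> slope v t" if "0 \<le> t" for t
  proof -
    have "(\<lambda>m. radial_mean n (source (iterate m)) t) \<longlonglongrightarrow> radial_mean n (source v) t"
    proof (rule radial_mean_tendsto [OF _ _ that src])
      show "continuous_on {0..} (source (iterate m))" for m
        by (intro source_cont trapped_profile trapped_iterate)
      show "continuous_on {0..} (source barrier)"
        by (intro source_cont trapped_profile trapped_barrier)
      show "\<bar>source (iterate m) s\<bar> \<le> source barrier s" if "0 \<le> s" for m s
        using bounds [OF that, of m] \<beta>_pos [OF that] \<gamma>
        by (auto simp: source_def abs_mult intro!: powr_mono2)
    qed
    then show ?thesis
      unfolding slope_def curvature_def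
      using mean_source_pos [OF trapped_profile [OF trap] that] c
      by (intro tendsto_mult tendsto_const tendsto_powr) auto
  qed
  have fix_eq: "v r = 1 + integral {0..r} (slope v)" if "0 \<le> r" for r
  proof -
    have "(\<lambda>m. integral {0..r} (slope (iterate m))) \<longlonglongrightarrow> integral {0..r} (slope v)"
    proof (rule dominated_convergence(2))
      show "slope (iterate m) integrable_on {0..r}" for m
        by (intro slope_integrable trapped_profile trapped_iterate order_refl)
      show "slope barrier integrable_on {0..r}"
        by (intro slope_integrable trapped_profile trapped_barrier order_refl)
      show "norm (slope (iterate m) t) \<le> slope barrier t" if "t \<in> {0..r}" for m t
        using that slope_nonneg [of t "iterate m"] bounds(2)
          slope_mono [OF trapped_profile [OF trapped_iterate] trapped_profile [OF trapped_barrier]]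
        by auto
      show "(\<lambda>m. slope (iterate m) t) \<longlonglongrightarrow> slope v t" if "t \<in> {0..r}" for t
        using that slope_lim by auto
    qed
    then have "(\<lambda>m. iterate (Suc m) r) \<longlonglongrightarrow> 1 + integral {0..r} (slope v)"
      unfolding iterate_Suc shoot_def by (intro tendsto_add tendsto_const)
    then show ?thesis
      using LIMSEQ_unique LIMSEQ_Suc [OF lim [OF that]] by blast
  qed
  show thesis
    by (rule that [of v]) (use trap trapped_profile inc ge1 fix_eq in auto)
qed

section \<open>A growth bound for radial solutions\<close>

text \<open>
  Positivity of the Laplacian (\<open>trace\<close>) makes \<open>r ^ (n - 1) * \<phi> r\<close> increasing, so the solution
  increases. Then the equation says that \<open>r ^ (n - k) * \<phi> r ^ k\<close> has derivative
  \<open>c * r ^ (n - 1) * source v r\<close>. Integrated from 0, this shows \<open>\<phi> = slope v\<close>, and \<open>slope_le\<close>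
  gives the separable inequality.
\<close>
lemma solution_energy_bound:
  assumes kn: "k \<le> n"
    and v: "\<And>r. (v has_real_derivative \<phi> r) (at r)"
    and \<phi>: "\<And>r. (\<phi> has_real_derivative \<phi>' r) (at r)" and \<phi>0: "\<phi> 0 = 0"
    and v_pos: "\<And>r. 0 < v r"
    and trace: "\<And>r. 0 < r \<Longrightarrow> 0 < (\<phi>' r - \<phi> r / r) + real n * (\<phi> r / r)"
    and eq: "\<And>r. 0 < r \<Longrightarrow> (\<phi> r / r) ^ (k - 1) * (real k * (\<phi>' r - \<phi> r / r) + real n * (\<phi> r / r))
              = c * source v r"
    and R: "0 \<le> R"
  shows "v R powr (1 - \<gamma> / real k) \<le> v 0 powr (1 - \<gamma> / real k)
    + (1 - \<gamma> / real k) * integral {0..R} (slope (\<lambda>_. 1))"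
proof -
  have v_cont: "continuous_on A v" and \<phi>_cont: "continuous_on A \<phi>" for A
    using v \<phi> by (meson DERIV_continuous_on has_field_derivative_at_within)+
  have prof: "profile v"
    using v_cont v_pos by (simp add: profile_def)
  have \<phi>_pos: "0 < \<phi> r" if "0 < r" for r
  proof -
    have "0 ^ (n - 1) * \<phi> 0 < r ^ (n - 1) * \<phi> r"
    proof (rule DERIV_pos_imp_increasing_open [OF that])
      show "continuous_on {0..r} (\<lambda>r. r ^ (n - 1) * \<phi> r)"
        by (intro continuous_intros \<phi>_cont)
      fix x assume x: "0 < x" "x < r"
      have "((\<lambda>r. r ^ (n - 1) * \<phi> r) has_real_derivative
          real (n - 1) * x ^ (n - 1 - 1) * \<phi> x + x ^ (n - 1) * \<phi>' x) (at x)"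
        by (auto intro!: derivative_eq_intros \<phi>)
      moreover have "real (n - 1) * x ^ (n - 1 - 1) * \<phi> x + x ^ (n - 1) * \<phi>' x
          = x ^ (n - 1) * ((\<phi>' x - \<phi> x / x) + real n * (\<phi> x / x))"
      proof (cases "n = 1")
        case False
        then have "x ^ (n - 1) = x * x ^ (n - 1 - 1)"
          using n by (cases "n - 1") auto
        then show ?thesis
          using x n by (simp add: field_simps of_nat_diff)
      qed (use x in auto)
      ultimately show "\<exists>y. ((\<lambda>r. r ^ (n - 1) * \<phi> r) has_real_derivative y) (at x) \<and> 0 < y"
        using trace [OF x(1)] x(1) by (metis mult_pos_pos zero_less_power)
    qed
    then show ?thesis
      using that by (simp add: \<phi>0 zero_less_mult_iff)
  qed
  have v_mono: "v s \<le> v r" if "0 \<le> s" "s \<le> r" for s r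
    by (rule DERIV_nonneg_imp_nondecreasing [OF that(2)])
       (metis \<phi>0 \<phi>_pos less_eq_real_def order_trans that(1) v)
  have \<phi>_eq: "\<phi> r = slope v r" if r: "0 \<le> r" for r
  proof (cases "r = 0")
    case False
    with r have r: "0 < r" by simp
    have "((\<lambda>x. c * (x ^ (n - 1) * source v x)) has_integral (r ^ (n - k) * \<phi> r ^ k - 0 ^ (n - k) * \<phi> 0 ^ k)) {0..r}"
    proof (rule fundamental_theorem_of_calculus_interior)
      show "continuous_on {0..r} (\<lambda>r. r ^ (n - k) * \<phi> r ^ k)"
        by (intro continuous_intros \<phi>_cont)
      fix x assume "x \<in> {0<..<r}"
      then have x: "0 < x" by simp
      have "((\<lambda>r. r ^ (n - k) * \<phi> r ^ k) has_real_derivative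
          real (n - k) * x ^ (n - k - 1) * \<phi> x ^ k + x ^ (n - k) * (real k * \<phi> x ^ (k - 1) * \<phi>' x)) (at x)"
        by (auto intro!: derivative_eq_intros \<phi>)
      also have "real (n - k) * x ^ (n - k - 1) * \<phi> x ^ k + x ^ (n - k) * (real k * \<phi> x ^ (k - 1) * \<phi>' x)
          = c * (x ^ (n - 1) * source v x)"
      proof -
        obtain j where j: "k = Suc j" using k by (cases k) auto
        obtain m where m: "n = k + m" using kn le_Suc_ex by blast
        have xx: "x ^ (n - 1) = x ^ m * x ^ j"
          by (simp add: j m power_add)
        have "c * (x ^ (n - 1) * source v x)
            = x ^ m * x ^ j * (c * source v x)"
          unfolding xx by (simp only: mult_ac)
        also have "c * source v x = (\<phi> x / x) ^ j * (real k * (\<phi>' x - \<phi> x / x) + real n * (\<phi> x / x))"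
          unfolding eq [OF x, symmetric] by (simp only: j diff_Suc_1)
        also have "x ^ m * x ^ j * ((\<phi> x / x) ^ j * (real k * (\<phi>' x - \<phi> x / x) + real n * (\<phi> x / x)))
            = x ^ m * (x ^ j * (\<phi> x / x) ^ j) * (real k * (\<phi>' x - \<phi> x / x) + real n * (\<phi> x / x))"
          by (simp only: mult.assoc)
        also have "x ^ j * (\<phi> x / x) ^ j = \<phi> x ^ j"
          using x by (simp flip: power_mult_distrib)
        also have "real k * (\<phi>' x - \<phi> x / x) + real n * (\<phi> x / x) = real k * \<phi>' x + real m * (\<phi> x / x)"
          by (simp add: m algebra_simps)
        also have "x ^ m * \<phi> x ^ j * (real k * \<phi>' x + real m * (\<phi> x / x))
            = real m * x ^ (m - 1) * \<phi> x ^ k + x ^ m * (real k * \<phi> x ^ j * \<phi>' x)"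
          using x by (cases m) (simp_all add: j field_simps)
        finally show ?thesis by (simp add: m j)
      qed
      finally show "((\<lambda>r. r ^ (n - k) * \<phi> r ^ k) has_vector_derivative c * (x ^ (n - 1) * source v x)) (at x)"
        by (simp add: has_real_derivative_iff_has_vector_derivative)
    qed (use r in auto)
    \<comment> \<open>For \<open>k = n\<close> the boundary term at 0 vanishes only because \<open>\<phi> 0 = 0\<close>.\<close>
    from integral_unique [OF this]
    have "integral {0..r} (\<lambda>x. c * (x ^ (n - 1) * source v x)) = r ^ (n - k) * \<phi> r ^ k"
      using k by (simp add: \<phi>0 power_0_left)
    then have "r ^ (n - k) * \<phi> r ^ k = c * (r ^ n * radial_mean n (source v) r)"
      using radial_mean_eq_integral [OF source_cont [OF prof] _ n, of r] r by simp
    also have "\<dots> = r ^ (n - k) * (r ^ k * curvature v r ^ k)"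
      using curvature_power [OF prof, of r] r kn by (simp flip: power_add add: mult.left_commute)
    finally have "\<phi> r ^ k = slope v r ^ k"
      using r by (simp add: slope_def power_mult_distrib)
    then show ?thesis
      using power_eq_imp_eq_base [of "\<phi> r" k "slope v r"] \<phi>_pos [OF r] slope_nonneg [of r v] r k by simp
  qed (simp add: \<phi>0 slope_def)
  let ?\<theta> = "1 - \<gamma> / real k"
  \<comment> \<open>Divide the separable inequality \<open>\<phi> \<le> v powr (\<gamma> / k) * slope 1\<close> by the power of \<open>v\<close> and integrate.\<close>
  have "((\<lambda>r. ?\<theta> * v r powr (- (\<gamma> / real k)) * \<phi> r) has_integral v R powr ?\<theta> - v 0 powr ?\<theta>) {0..R}"
  proof (rule fundamental_theorem_of_calculus [OF R])
    fix x
    have "((\<lambda>r. v r powr ?\<theta>) has_real_derivative ?\<theta> * v x powr (?\<theta> - 1) * \<phi> x) (at x)"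
      by (rule DERIV_chain' [OF v has_real_derivative_powr [OF v_pos]])
    then show "((\<lambda>r. v r powr ?\<theta>) has_vector_derivative ?\<theta> * v x powr (- (\<gamma> / real k)) * \<phi> x) (at x within {0..R})"
      by (simp add: has_real_derivative_iff_has_vector_derivative has_vector_derivative_at_within)
  qed
  moreover have "((\<lambda>r. ?\<theta> * slope (\<lambda>_. 1) r) has_integral ?\<theta> * integral {0..R} (slope (\<lambda>_. 1))) {0..R}"
    by (intro has_integral_mult_right integrable_integral slope_integrable profile_const order_refl)
  ultimately have "v R powr ?\<theta> - v 0 powr ?\<theta> \<le> ?\<theta> * integral {0..R} (slope (\<lambda>_. 1))"
  proof (rule has_integral_le)
    fix x assume "x \<in> {0..R}"
    then have x: "0 \<le> x" by simp
    have "\<phi> x \<le> v x powr (\<gamma> / real k) * slope (\<lambda>_. 1) x"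
      unfolding \<phi>_eq [OF x] by (intro slope_le prof x v_mono)
    then have "v x powr (- (\<gamma> / real k)) * \<phi> x
        \<le> v x powr (- (\<gamma> / real k)) * (v x powr (\<gamma> / real k) * slope (\<lambda>_. 1) x)"
      by (intro mult_left_mono) auto
    also have "\<dots> = slope (\<lambda>_. 1) x"
      using v_pos [of x] by (simp flip: powr_add mult.assoc)
    finally show "?\<theta> * v x powr (- (\<gamma> / real k)) * \<phi> x \<le> ?\<theta> * slope (\<lambda>_. 1) x"
      using exponent by (simp add: mult.assoc)
  qed
  then show ?thesis by simp
qed

end

section \<open>The characterisation\<close>

text \<open>
  By monotone convergence the integral over the half-line is the supremum of the integrals over
  \<open>{0..m}\<close>, and these are ordinary integrals of a continuous function.
\<close>
lemma nn_integral_atLeast_infinite_iff: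
  fixes f :: "real \<Rightarrow> real"
  assumes cont: "continuous_on {0..} f" and nonneg: "\<And>r. 0 \<le> r \<Longrightarrow> 0 \<le> f r"
  shows "(\<integral>\<^sup>+ r \<in> {0..}. ennreal (f r) \<partial>lborel) = \<infinity> \<longleftrightarrow> (\<forall>B. \<exists>R\<ge>0. B < integral {0..R} f)"
proof -
  have fin: "(\<integral>\<^sup>+ r \<in> {0..R}. ennreal (f r) \<partial>lborel) = ennreal (integral {0..R} f)" for R
  proof (rule nn_integral_has_integral_lebesgue')
    show "(f has_integral integral {0..R} f) {0..R}"
      by (rule integrable_integral, rule integrable_continuous_real, rule continuous_on_subset [OF cont]) auto
  qed (use nonneg in auto)
  let ?g = "\<lambda>m r. ennreal (f r) * indicator {0..real m} r"
  have mono: "mono (\<lambda>m. ?g m r)" for r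
    by (auto simp: mono_def indicator_def)
  have "(\<lambda>x. indicator {0..R} x *\<^sub>R f x) \<in> borel_measurable borel" for R
    by (rule borel_measurable_continuous_on_indicator) (auto intro: continuous_on_subset [OF cont])
  then have "(\<lambda>x. ennreal (indicator {0..R} x *\<^sub>R f x)) \<in> borel_measurable borel" for R
    by measurable
  moreover have "(\<lambda>x. ennreal (indicator {0..R} x *\<^sub>R f x)) = (\<lambda>x. ennreal (f x) * indicator {0..R} x)" for R
    by (auto simp: indicator_def)
  ultimately have meas: "?g m \<in> borel_measurable lborel" for m
    by simp
  have "(SUP m. ?g m r) = ennreal (f r) * indicator {0..} r" for r
  proof (rule antisym)
    show "(SUP m. ?g m r) \<le> ennreal (f r) * indicator {0..} r"
      by (rule SUP_least) (auto simp: indicator_def)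
    obtain m where "r \<le> real m" using real_arch_simple by blast
    then have "ennreal (f r) * indicator {0..} r \<le> ?g m r"
      by (auto simp: indicator_def)
    then show "ennreal (f r) * indicator {0..} r \<le> (SUP m. ?g m r)"
      by (rule SUP_upper2 [OF UNIV_I])
  qed
  then have "(\<integral>\<^sup>+ r \<in> {0..}. ennreal (f r) \<partial>lborel) = (\<integral>\<^sup>+ r. (SUP m. ?g m r) \<partial>lborel)"
    by simp
  also have "\<dots> = (SUP m. \<integral>\<^sup>+ r. ?g m r \<partial>lborel)"
    using mono by (intro nn_integral_monotone_convergence_SUP meas) (auto simp: incseq_def le_fun_def mono_def)
  finally have sup: "(\<integral>\<^sup>+ r \<in> {0..}. ennreal (f r) \<partial>lborel) = (SUP m. ennreal (integral {0..real m} f))"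
    by (simp add: fin)
  show ?thesis
  proof
    assume inf: "(\<integral>\<^sup>+ r \<in> {0..}. ennreal (f r) \<partial>lborel) = \<infinity>"
    show "\<forall>B. \<exists>R\<ge>0. B < integral {0..R} f"
    proof (rule ccontr)
      assume "\<not> ?thesis"
      then obtain B where B: "\<And>R. 0 \<le> R \<Longrightarrow> integral {0..R} f \<le> B"
        by (metis not_le)
      have "(SUP m. ennreal (integral {0..real m} f)) \<le> ennreal B"
        by (intro SUP_least ennreal_leI B) simp
      then have "\<infinity> \<le> ennreal B"
        by (simp only: inf flip: sup)
      then show False
        by (simp add: top_unique)
    qed
  next
    assume unb: "\<forall>B. \<exists>R\<ge>0. B < integral {0..R} f"
    show "(\<integral>\<^sup>+ r \<in> {0..}. ennreal (f r) \<partial>lborel) = \<infinity>"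
    proof (rule ccontr)
      assume "\<not> ?thesis"
      then obtain B where B: "0 \<le> B" "(\<integral>\<^sup>+ r \<in> {0..}. ennreal (f r) \<partial>lborel) = ennreal B"
        by (cases "\<integral>\<^sup>+ r \<in> {0..}. ennreal (f r) \<partial>lborel" rule: ennreal_cases) auto
      obtain R where R: "0 \<le> R" "B < integral {0..R} f"
        using unb by blast
      have "ennreal (integral {0..R} f) \<le> (\<integral>\<^sup>+ r \<in> {0..}. ennreal (f r) \<partial>lborel)"
        unfolding fin [symmetric] by (intro nn_integral_mono) (auto simp: indicator_def)
      then show False
        using B R by (simp add: ennreal_le_iff)
    qed
  qed
qed

text \<open>
  The global profile \<open>v\<close> of the integral equation, read as a radial function. All conditions on the
  Hessian reduce to the formula for \<open>S j\<close> in terms of \<open>curvature v\<close> and \<open>anisotropy v\<close>.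
\<close>
lemma radial_equation_solvable:
  fixes b :: "real^'n \<Rightarrow> real" and b0 :: "real \<Rightarrow> real"
  assumes "radial_problem CARD('n) k (real CARD('n) / real (CARD('n) choose k)) \<gamma> b0"
    and "k \<le> CARD('n)" and b: "\<And>x. b x = b0 (norm x)"
    and unb: "\<forall>B. \<exists>R\<ge>0. B < integral {0..R}
      (radial_problem.slope CARD('n) k (real CARD('n) / real (CARD('n) choose k)) \<gamma> b0 (\<lambda>_. 1))"
  shows "\<exists>u :: real^'n \<Rightarrow> real.
            u \<in> k_convex k UNIV \<and> radial u \<and> (\<forall>x. u x > 0) \<and>
            (\<forall>x. S k (hessian u x) = b x * u x powr \<gamma>) \<and>
            filterlim u at_top at_infinity"
proof -
  interpret radial_problem "CARD('n)" k "real CARD('n) / real (CARD('n) choose k)" \<gamma> b0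
    by (rule assms(1))
  obtain v where v: "profile v" "\<And>s r. 0 \<le> s \<Longrightarrow> s \<le> r \<Longrightarrow> v s \<le> v r"
      "\<And>r. 0 \<le> r \<Longrightarrow> 1 \<le> v r" "\<And>r. 0 \<le> r \<Longrightarrow> v r = 1 + integral {0..r} (slope v)"
    using exists_global_profile by blast
  define u :: "real^'n \<Rightarrow> real" where "u = (\<lambda>x. v (norm x))"
  have dv: "(v has_real_derivative slope v r) (at r within {0..})" if "0 \<le> r" for r
    by (rule fixed_profile_has_derivative [OF v(1,4) that])
  have dv_pos: "(v has_real_derivative r * curvature v r) (at r)" if "0 < r" for r
    using dv [of r] that at_within_interior [of r "{0..}"] by (simp add: slope_def)
  have dv_0: "(v has_real_derivative 0) (at 0 within {0..})"
    using dv [of 0] by (simp add: slope_def)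
  have C2: "C2_on UNIV u" and hess: "hessian u x = radial_matrix (curvature v (norm x)) (anisotropy v (norm x)) (sgn x)" for x
    unfolding u_def
    by (intro radial_C2 [where p = "anisotropy v" and q = "curvature v"] dv_pos dv_0
          curvature_has_derivative curvature_cont anisotropy_cont anisotropy_0 v(1); assumption)+
  have S: "S j (hessian u x) = real (CARD('n) choose j) / real CARD('n) * curvature v (norm x) ^ (j - 1)
      * (real j * anisotropy v (norm x) + real CARD('n) * curvature v (norm x))" if "1 \<le> j" for j x
    unfolding hess by (rule S_radial_matrix [OF _ that]) (use anisotropy_0 [OF v(1)] in \<open>auto simp: norm_sgn\<close>)
  have choose_pos: "0 < real (CARD('n) choose j)" if "j \<le> k" for j
    using that assms(2) by (simp add: zero_less_binomial)
  have eq: "S k (hessian u x) = b x * u x powr \<gamma>" for x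
  proof -
    have "S k (hessian u x) = real (CARD('n) choose k) / real CARD('n) *
        (real CARD('n) / real (CARD('n) choose k) * source v (norm x))"
      unfolding S [OF k] mult.assoc anisotropy_eq [OF v(1) norm_ge_zero, symmetric] ..
    also have "\<dots> = source v (norm x)"
      using choose_pos [of k] by simp
    finally show ?thesis
      by (simp add: source_def b u_def)
  qed
  have S_pos: "0 < S j (hessian u x)" if "j \<in> {1..k}" for j x
  proof -
    let ?q = "curvature v (norm x)" and ?p = "anisotropy v (norm x)"
    have q: "0 < ?q"
      by (rule curvature_pos [OF v(1) norm_ge_zero])
    have "0 < ?q ^ (k - 1) * (real k * ?p + real CARD('n) * ?q)"
      unfolding anisotropy_eq [OF v(1) norm_ge_zero]
      using c source_pos [OF v(1) norm_ge_zero [of x]] by (rule mult_pos_pos)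
    then have kpos: "0 < real k * ?p + real CARD('n) * ?q"
      using q by (simp add: zero_less_mult_iff)
    have "0 < real j * ?p + real CARD('n) * ?q"
    proof (cases "0 \<le> ?p")
      case True
      then show ?thesis using q by (simp add: add_nonneg_pos)
    next
      case False
      \<comment> \<open>For negative \<open>p\<close> the expression \<open>j * p + n * q\<close> is smallest at \<open>j = k\<close>, where the equation makes it positive.\<close>
      then have "real k * ?p \<le> real j * ?p"
        using that by (intro mult_right_mono_neg) auto
      then show ?thesis using kpos by simp
    qed
    then show ?thesis
      using S [of j x] that q choose_pos [of j] by simp
  qed
  have "u \<in> k_convex k UNIV"
    using C2 S_pos by (auto simp: k_convex_def Gamma_cone_def S_def)
  moreover have "radial u"
    by (simp add: radial_def u_def)
  moreover have "\<forall>x. 0 < u x"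
    using profileD(2) [OF v(1)] by (simp add: u_def)
  moreover have "filterlim u at_top at_infinity"
  proof -
    have "filterlim v at_top at_top"
      unfolding filterlim_at_top eventually_at_top_linorder
    proof
      fix Z
      obtain R where R: "0 \<le> R" "Z < integral {0..R} (slope (\<lambda>_. 1))"
        using unb by blast
      have "integral {0..R} (slope (\<lambda>_. 1)) \<le> integral {0..R} (slope v)"
        using v(1,3) by (intro integral_le slope_integrable slope_mono profile_const order_refl) auto
      then have "Z \<le> v R"
        using R v(4) by simp
      then show "\<exists>N. \<forall>r\<ge>N. Z \<le> v r"
        using v(2) [OF R(1)] order_trans by blast
    qed
    then show ?thesis
      unfolding u_def by (rule filterlim_compose [OF _ filterlim_norm_at_top])
  qed
  ultimately show ?thesis
    using eq by blast
qed

text \<open>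
  The profile of a k-convex solution satisfies the hypotheses of \<open>solution_energy_bound\<close>: the case
  \<open>j = 1\<close> of k-convexity is positivity of the trace, and the equation itself is the case \<open>j = k\<close>.
  As the left-hand side of the bound is unbounded, so is the integral.
\<close>
lemma radial_solution_unbounded_integral:
  fixes b u :: "real^'n \<Rightarrow> real" and b0 :: "real \<Rightarrow> real"
  assumes "radial_problem CARD('n) k (real CARD('n) / real (CARD('n) choose k)) \<gamma> b0"
    and "k \<le> CARD('n)" and b: "\<And>x. b x = b0 (norm x)"
    and u: "u \<in> k_convex k UNIV" "radial u" "\<And>x. u x > 0"
    and eq: "\<And>x. S k (hessian u x) = b x * u x powr \<gamma>"
    and blowup: "filterlim u at_top at_infinity"
  shows "\<exists>R\<ge>0. B < integral {0..R}
      (radial_problem.slope CARD('n) k (real CARD('n) / real (CARD('n) choose k)) \<gamma> b0 (\<lambda>_. 1))"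
proof -
  interpret radial_problem "CARD('n)" k "real CARD('n) / real (CARD('n) choose k)" \<gamma> b0
    by (rule assms(1))
  obtain m :: 'n where True by simp
  define e :: "real^'n" where "e = axis m 1"
  have e: "norm e = 1" by (simp add: e_def)
  have "C2_on UNIV u"
    using u(1) by (simp add: k_convex_def)
  then obtain \<phi> \<phi>' where \<phi>: "\<And>r. ((\<lambda>r. u (r *\<^sub>R e)) has_real_derivative \<phi> r) (at r)"
      "\<And>r. (\<phi> has_real_derivative \<phi>' r) (at r)" "\<phi> 0 = 0"
      "\<And>r. 0 < r \<Longrightarrow> hessian u (r *\<^sub>R e) = radial_matrix (\<phi> r / r) (\<phi>' r - \<phi> r / r) e"
    using radial_C2_profile [OF _ u(2) e] by blast
  let ?v = "\<lambda>r. u (r *\<^sub>R e)"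
  have S: "S j (hessian u (r *\<^sub>R e)) = real (CARD('n) choose j) / real CARD('n) * (\<phi> r / r) ^ (j - 1)
      * (real j * (\<phi>' r - \<phi> r / r) + real CARD('n) * (\<phi> r / r))" if "0 < r" "1 \<le> j" for j r
    unfolding \<phi>(4) [OF that(1)] by (rule S_radial_matrix [OF _ that(2)]) (use e in simp)
  have choose_pos: "0 < real (CARD('n) choose k)"
    using assms(2) by (simp add: zero_less_binomial)
  have trace: "0 < (\<phi>' r - \<phi> r / r) + real CARD('n) * (\<phi> r / r)" if "0 < r" for r
  proof -
    have "0 < S 1 (hessian u (r *\<^sub>R e))"
      using u(1) k by (auto simp: k_convex_def Gamma_cone_def S_def)
    then show ?thesis
      using S [OF that order_refl] by simp
  qed
  have equation: "(\<phi> r / r) ^ (k - 1) * (real k * (\<phi>' r - \<phi> r / r) + real CARD('n) * (\<phi> r / r))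
      = real CARD('n) / real (CARD('n) choose k) * source ?v r" if "0 < r" for r
  proof -
    let ?X = "(\<phi> r / r) ^ (k - 1) * (real k * (\<phi>' r - \<phi> r / r) + real CARD('n) * (\<phi> r / r))"
    have "source ?v r = S k (hessian u (r *\<^sub>R e))"
      using that e by (simp add: source_def b eq)
    also have "\<dots> = real (CARD('n) choose k) / real CARD('n) * ?X"
      using S [OF that k] by (simp only: mult.assoc)
    finally show ?thesis
      using choose_pos by simp
  qed
  let ?\<theta> = "1 - \<gamma> / real k"
  let ?I = "\<lambda>R. integral {0..R} (slope (\<lambda>_. 1))"
  have bound: "?v R powr ?\<theta> \<le> ?v 0 powr ?\<theta> + ?\<theta> * ?I R" if "0 \<le> R" for R
    by (rule solution_energy_bound [OF assms(2) \<phi>(1-3) u(3) trace equation that])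
  \<comment> \<open>Once \<open>u\<close> exceeds \<open>Z\<close>, the bound forces the integral to exceed \<open>\<bar>B\<bar>\<close>.\<close>
  define Z where "Z = (?v 0 powr ?\<theta> + ?\<theta> * \<bar>B\<bar>) powr (1 / ?\<theta>)"
  have "eventually (\<lambda>x. Z + 1 \<le> u x) at_infinity"
    using blowup unfolding filterlim_at_top by blast
  then obtain N where N: "\<And>x. N \<le> norm x \<Longrightarrow> Z + 1 \<le> u x"
    unfolding eventually_at_infinity by blast
  let ?R = "\<bar>N\<bar>"
  have "Z < ?v ?R"
    using N [of "?R *\<^sub>R e"] e abs_ge_self [of N] by simp
  moreover have "0 \<le> Z"
    by (simp add: Z_def)
  ultimately have "Z powr ?\<theta> < ?v ?R powr ?\<theta>"
    using exponent by (intro powr_less_mono2) auto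
  moreover have "Z powr ?\<theta> = ?v 0 powr ?\<theta> + ?\<theta> * \<bar>B\<bar>"
  proof -
    have "0 \<le> ?v 0 powr ?\<theta> + ?\<theta> * \<bar>B\<bar>"
      using exponent by (intro add_nonneg_nonneg mult_nonneg_nonneg) auto
    then show ?thesis
      unfolding Z_def powr_powr using exponent by simp
  qed
  ultimately have "?\<theta> * \<bar>B\<bar> < ?\<theta> * ?I ?R"
    using bound [of ?R] by simp
  then have "B < ?I ?R"
    using exponent by (simp add: mult_less_cancel_left)
  then show ?thesis
    by (intro exI [of _ ?R]) simp
qed

theorem corollary1p3:
  fixes b :: "real^'n \<Rightarrow> real" and b0 :: "real \<Rightarrow> real" and k :: nat and \<gamma> :: real
  assumes "CARD('n) \<ge> 3"
    and "k \<in> {1..CARD('n)}"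
    and "0 < \<gamma>" and "\<gamma> < real k"
    and "continuous_on UNIV b"
    and "\<forall>x. b x > 0"
    and "\<forall>x. b x = b0 (norm x)"
  shows "(\<exists>u :: real^'n \<Rightarrow> real.
            u \<in> k_convex k UNIV \<and> radial u \<and> (\<forall>x. u x > 0) \<and>
            (\<forall>x. S k (hessian u x) = b x * u x powr \<gamma>) \<and>
            filterlim u at_top at_infinity)
     \<longleftrightarrow>
     (\<integral>\<^sup>+ r \<in> {0..}.
        ennreal ((real CARD('n) * r powi (int k - int CARD('n)) / real (CARD('n) choose k)
                  * integral {0..r} (\<lambda>s. s ^ (CARD('n) - 1) * b0 s)) powr (1 / real k))
        \<partial>lborel) = \<infinity>"
proof -
  let ?n = "CARD('n)"
  let ?c = "real ?n / real (?n choose k)"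
  obtain m :: 'n where True by simp
  have b0: "b0 r = b (r *\<^sub>R axis m 1)" if "0 \<le> r" for r
    using that assms(7) by simp
  have problem: "radial_problem ?n k ?c \<gamma> b0"
  proof
    have "continuous_on {0..} (\<lambda>r. b (r *\<^sub>R axis m 1))"
      by (intro continuous_on_compose2 [OF assms(5)] continuous_intros) auto
    then show "continuous_on {0..} b0"
      by (rule continuous_on_eq) (use b0 in auto)
    show "0 < b0 r" if "0 \<le> r" for r
      using b0 [OF that] assms(6) by simp
  qed (use assms in \<open>auto simp: zero_less_binomial\<close>)
  interpret radial_problem ?n k ?c \<gamma> b0
    by (rule problem)
  have "(\<integral>\<^sup>+ r \<in> {0..}.
        ennreal ((real ?n * r powi (int k - int ?n) / real (?n choose k)
                  * integral {0..r} (\<lambda>s. s ^ (?n - 1) * b0 s)) powr (1 / real k)) \<partial>lborel)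
      = (\<integral>\<^sup>+ r \<in> {0..}. ennreal (slope (\<lambda>_. 1) r) \<partial>lborel)"
  proof (intro nn_integral_cong)
    fix r :: real
    have "(real ?n * r powi (int k - int ?n) / real (?n choose k)
        * integral {0..r} (\<lambda>s. s ^ (?n - 1) * b0 s)) powr (1 / real k) = slope (\<lambda>_. 1) r" if "0 \<le> r"
      by (rule slope_one_eq [OF that]) (use assms(2) in \<open>auto simp: zero_less_binomial\<close>)
    note on_half_line = this
    show "ennreal ((real ?n * r powi (int k - int ?n) / real (?n choose k)
        * integral {0..r} (\<lambda>s. s ^ (?n - 1) * b0 s)) powr (1 / real k)) * indicator {0..} r
        = ennreal (slope (\<lambda>_. 1) r) * indicator {0..} r"
    proof (cases "0 \<le> r")
      case True
      then show ?thesis by (simp only: on_half_line)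
    qed simp
  qed
  also have "\<dots> = \<infinity> \<longleftrightarrow> (\<forall>B. \<exists>R\<ge>0. B < integral {0..R} (slope (\<lambda>_. 1)))"
    by (rule nn_integral_atLeast_infinite_iff [OF slope_cont [OF profile_const] slope_nonneg])
  finally have crit: "(\<integral>\<^sup>+ r \<in> {0..}.
        ennreal ((real ?n * r powi (int k - int ?n) / real (?n choose k)
                  * integral {0..r} (\<lambda>s. s ^ (?n - 1) * b0 s)) powr (1 / real k)) \<partial>lborel) = \<infinity>
      \<longleftrightarrow> (\<forall>B. \<exists>R\<ge>0. B < integral {0..R} (slope (\<lambda>_. 1)))" .
  have kn: "k \<le> ?n" and b: "\<And>x. b x = b0 (norm x)"
    using assms(2,7) by auto
  show ?thesis
    unfolding crit
  proof
    assume "\<forall>B. \<exists>R\<ge>0. B < integral {0..R} (slope (\<lambda>_. 1))"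
    then show "\<exists>u :: real^'n \<Rightarrow> real. u \<in> k_convex k UNIV \<and> radial u \<and> (\<forall>x. u x > 0) \<and>
        (\<forall>x. S k (hessian u x) = b x * u x powr \<gamma>) \<and> filterlim u at_top at_infinity"
      by (rule radial_equation_solvable [OF problem kn b])
  qed (use radial_solution_unbounded_integral [OF problem kn b] in blast)
qed

end
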